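(* Every tree product of infinite cyclic groups is a Garside group; that is, for every finite weighted tree $\mathcal{T}$, the group $G(\mathcal{T})$ is a Garside group.
   Context: A monoid $M$ is cancellative if $abc=adc$ implies $b=d$ for all $a,b,c,d\in M$; it is conical if $ab=1$ implies $a=b=1$. For $a,b\in M$, $b$ is a left-divisor of $a$ (and $a$ a right-multiple of $b$) if $a=bd$ for some $d\in M$. A right-lcm of $a,b$ is a common right-multiple $c$ of $a$ and $b$ such that every common right-multiple of $a$ and $b$ is a right-multiple of $c$. Right-divisors, left-multiples and left-lcms are defined symmetrically. A Garside element of $M$ is an element whose left-divisors and right-divisors coincide, are finite in number, and generate $M$. A monoid $M$ is Garside if it is conical and cancellative, every pair of elements of $M$ admits a left-lcm and a right-lcm, and $M$ admits a Garside element. The enveloping group of a monoid is the group admitting the same presentation as the monoid. A group is a Garside group if it is the enveloping group (equivalently, the group of fractions) of some Garside monoid. A weighted tree $\mathcal{T}$ is a tree with vertex set $V(\mathcal{T})$ and edge set $E(\mathcal{T})$ together with a weight map $\omega$ which associates with every edge between two vertices $a$ and $b$ two nonzero integer weights $\omega_{a,b}$ and $\omega_{b,a}$. The tree product (of infinite cyclic groups) $G(\mathcal{T})$ is the group presented by $\langle\, a\in V(\mathcal{T}) : a^{\omega_{a,b}}=b^{\omega_{b,a}} \text{ for } \{a,b\}\in E(\mathcal{T})\,\rangle$. *)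

theory Defs
  imports
    "HOL-Algebra.Coset"
    "HOL-Algebra.Divisibility"
    "Graph_Theory.Pair_Digraph"
    "Graph_Theory.Digraph_Component"
begin

section \<open>Garside monoids\<close>

text \<open>
  The library relation \<open>a divides\<^bsub>M\<^esub> b\<close> means \<open>b = a \<otimes>\<^bsub>M\<^esub> c\<close> for some \<open>c\<close>, so in a
  non-commutative monoid it is left-divisibility.
\<close>

definition right_divides :: "('a, 'b) monoid_scheme \<Rightarrow> 'a \<Rightarrow> 'a \<Rightarrow> bool" where
  "right_divides M a b \<longleftrightarrow> (\<exists>c \<in> carrier M. b = c \<otimes>\<^bsub>M\<^esub> a)"

definition left_divisors :: "('a, 'b) monoid_scheme \<Rightarrow> 'a \<Rightarrow> 'a set" where
  "left_divisors M a = {b \<in> carrier M. b divides\<^bsub>M\<^esub> a}"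

definition right_divisors :: "('a, 'b) monoid_scheme \<Rightarrow> 'a \<Rightarrow> 'a set" where
  "right_divisors M a = {b \<in> carrier M. right_divides M b a}"

definition is_right_lcm :: "('a, 'b) monoid_scheme \<Rightarrow> 'a \<Rightarrow> 'a \<Rightarrow> 'a \<Rightarrow> bool" where
  "is_right_lcm M a b c \<longleftrightarrow>
     c \<in> carrier M \<and> a divides\<^bsub>M\<^esub> c \<and> b divides\<^bsub>M\<^esub> c \<and>
     (\<forall>d \<in> carrier M. a divides\<^bsub>M\<^esub> d \<and> b divides\<^bsub>M\<^esub> d \<longrightarrow> c divides\<^bsub>M\<^esub> d)"

definition is_left_lcm :: "('a, 'b) monoid_scheme \<Rightarrow> 'a \<Rightarrow> 'a \<Rightarrow> 'a \<Rightarrow> bool" where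
  "is_left_lcm M a b c \<longleftrightarrow>
     c \<in> carrier M \<and> right_divides M a c \<and> right_divides M b c \<and>
     (\<forall>d \<in> carrier M. right_divides M a d \<and> right_divides M b d \<longrightarrow> right_divides M c d)"

definition conical :: "('a, 'b) monoid_scheme \<Rightarrow> bool" where
  "conical M \<longleftrightarrow>
     (\<forall>a \<in> carrier M. \<forall>b \<in> carrier M. a \<otimes>\<^bsub>M\<^esub> b = \<one>\<^bsub>M\<^esub> \<longrightarrow> a = \<one>\<^bsub>M\<^esub> \<and> b = \<one>\<^bsub>M\<^esub>)"

definition garside_element :: "('a, 'b) monoid_scheme \<Rightarrow> 'a \<Rightarrow> bool" where
  "garside_element M g \<longleftrightarrow>
     g \<in> carrier M \<and>
     left_divisors M g = right_divisors M g \<and>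
     finite (left_divisors M g) \<and>
     (\<lambda>H. submonoid H M) hull left_divisors M g = carrier M"

definition garside_monoid :: "('a, 'b) monoid_scheme \<Rightarrow> bool" where
  "garside_monoid M \<longleftrightarrow>
     monoid_cancel M \<and> conical M \<and>
     (\<forall>a \<in> carrier M. \<forall>b \<in> carrier M. (\<exists>c. is_left_lcm M a b c) \<and> (\<exists>c. is_right_lcm M a b c)) \<and>
     (\<exists>g. garside_element M g)"


section \<open>Monoid and group presentations\<close>

text \<open>
  A presentation consists of a set \<open>S\<close> of generators and a set \<open>R\<close> of pairs of words over \<open>S\<close>;
  \<open>presentation_cong S R\<close> is the least congruence on the free monoid \<open>lists S\<close> containing \<open>R\<close>.
\<close>

inductive_set presentation_cong :: "'a set \<Rightarrow> ('a list \<times> 'a list) set \<Rightarrow> ('a list \<times> 'a list) set"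
  for S R where
  refl: "w \<in> lists S \<Longrightarrow> (w, w) \<in> presentation_cong S R"
| sym: "(v, w) \<in> presentation_cong S R \<Longrightarrow> (w, v) \<in> presentation_cong S R"
| trans: "(u, v) \<in> presentation_cong S R \<Longrightarrow> (v, w) \<in> presentation_cong S R \<Longrightarrow>
    (u, w) \<in> presentation_cong S R"
| rel: "(l, r) \<in> R \<Longrightarrow> u \<in> lists S \<Longrightarrow> v \<in> lists S \<Longrightarrow>
    (u @ l @ v, u @ r @ v) \<in> presentation_cong S R"

definition presented_monoid :: "'a set \<Rightarrow> ('a list \<times> 'a list) set \<Rightarrow> 'a list set monoid" where
  "presented_monoid S R =
     \<lparr>carrier = lists S // presentation_cong S R,
      mult = (\<lambda>X Y. \<Union>x \<in> X. \<Union>y \<in> Y. presentation_cong S R `` {x @ y}),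
      one = presentation_cong S R `` {[]}\<rparr>"

text \<open>
  Group words over \<open>S\<close> are words over \<open>S \<times> UNIV\<close>: the letter \<open>(a, True)\<close> stands for \<open>a\<close> and
  \<open>(a, False)\<close> for its inverse.
\<close>

definition presented_group ::
    "'a set \<Rightarrow> (('a \<times> bool) list \<times> ('a \<times> bool) list) set \<Rightarrow> ('a \<times> bool) list set monoid" where
  "presented_group S R =
     presented_monoid (S \<times> UNIV) (R \<union> {([(a, e), (a, \<not> e)], []) | a e. a \<in> S})"

definition positive_word :: "'a list \<Rightarrow> ('a \<times> bool) list" where
  "positive_word w = map (\<lambda>a. (a, True)) w"

definition enveloping_group ::
    "'a set \<Rightarrow> ('a list \<times> 'a list) set \<Rightarrow> ('a \<times> bool) list set monoid" where
  "enveloping_group S R =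
     presented_group S ((\<lambda>(l, r). (positive_word l, positive_word r)) ` R)"


section \<open>Garside groups\<close>

text \<open>
  A Garside monoid is finitely generated, by the divisors of a Garside element, so it is up to
  isomorphism presented on a set of natural numbers; hence taking the generators in \<open>nat\<close> loses
  no generality.  The clause \<open>group G\<close> is needed because \<open>\<cong>\<close> does not constrain \<open>\<one>\<^bsub>G\<^esub>\<close>.
\<close>

definition garside_group :: "('a, 'b) monoid_scheme \<Rightarrow> bool" where
  "garside_group G \<longleftrightarrow>
     group G \<and>
     (\<exists>(S :: nat set) R. R \<subseteq> lists S \<times> lists S \<and>
        garside_monoid (presented_monoid S R) \<and> G \<cong> enveloping_group S R)"


section \<open>Tree products of infinite cyclic groups\<close>

text \<open>
  A finite simple graph is a symmetric loop-free finite digraph (\<open>pair_graph\<close>), each edge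
  \<open>{a, b}\<close> being represented by both arcs \<open>(a, b)\<close> and \<open>(b, a)\<close>.  Going back and forth along an
  edge is then a \<open>cycle\<close> of length 2 for the library, so its predicate \<open>tree\<close>, which forbids
  all directed cycles, is not applicable; the cycles of the undirected graph are those of
  length at least 3.  The library's \<open>connected\<close> includes nonemptiness.
\<close>

definition finite_tree :: "'v pair_pre_digraph \<Rightarrow> bool" where
  "finite_tree T \<longleftrightarrow>
     pair_graph T \<and> Digraph_Component.connected (with_proj T) \<and>
     \<not> (\<exists>p. pre_digraph.cycle (with_proj T) p \<and> 3 \<le> length p)"

text \<open>The weight \<open>\<omega>\<^sub>a\<^sub>,\<^sub>b\<close> is \<open>\<omega> a b\<close>; only its values on arcs are relevant.\<close>

definition finite_weighted_tree :: "'v pair_pre_digraph \<Rightarrow> ('v \<Rightarrow> 'v \<Rightarrow> int) \<Rightarrow> bool" where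
  "finite_weighted_tree T \<omega> \<longleftrightarrow> finite_tree T \<and> (\<forall>(a, b) \<in> parcs T. \<omega> a b \<noteq> 0)"

definition power_word :: "'a \<Rightarrow> int \<Rightarrow> ('a \<times> bool) list" where
  "power_word a k = replicate (nat \<bar>k\<bar>) (a, 0 \<le> k)"

definition tree_product ::
    "'v pair_pre_digraph \<Rightarrow> ('v \<Rightarrow> 'v \<Rightarrow> int) \<Rightarrow> ('v \<times> bool) list set monoid" where
  "tree_product T \<omega> =
     presented_group (pverts T)
       {(power_word a (\<omega> a b), power_word b (\<omega> b a)) | a b. (a, b) \<in> parcs T}"

end

theory Submission
  imports Defs
begin

text \<open>
  The proof has an algebraic and a combinatorial half.

  \<^emph>\<open>Algebra.\<close> For positive weights the relations \<open>a\<^sup>p = b\<^sup>q\<close> of the tree present a monoid, and this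
  monoid is Garside.  The tree is built one leaf at a time: a new vertex \<open>c\<close> attached to \<open>b\<close> by
  \<open>b\<^sup>n = c\<^sup>m\<close> turns the monoid \<open>M\<close> into the amalgamated product of \<open>M\<close> and the free monoid on \<open>c\<close>, in
  which the cyclic submonoid \<open>U\<close> of \<open>b\<^sup>n\<close> is identified with that of \<open>c\<^sup>m\<close>.  If \<open>M\<close> is left
  cancellative and words have weights that respect the relations, then each element of \<open>M\<close> is
  \<open>x\<^sup>k w\<close> with \<open>x = b\<^sup>n\<close>, for a unique \<open>k\<close> and a unique \<open>w\<close> that \<open>x\<close> does not divide: under left
  multiplication by \<open>U\<close> both factors are free.  Hence the amalgam acts on formal normal forms, powers
  of \<open>x\<close> followed by alternating syllables from the two factors, and this action is faithful (the
  trick of van der Waerden for free products).  It gives left cancellation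
  (\<open>left_cancel_amalgam\<close>) and shows that divisibility by an element of a factor can be decided in
  that factor (\<open>left_dvd_factor_iff\<close>), so that any two letters have a right lcm
  (\<open>right_lcm_letters\<close>).

  Lcms of letters are enough: in a left cancellative monoid with weights, right lcms of pairs of
  letters propagate to all pairs with a common multiple (\<open>right_lcm_if_letters\<close>).  Common multiples
  exist because suitable powers of all the letters of a tree coincide; their common value is central
  and divisible by all letters, and it is also the Garside element.  The symmetric
  half of the axioms follows, since both sides of each relation are palindromes
  and reversal of words exchanges left and right (\<open>garside_monoid_presented\<close>).

  \<^emph>\<open>Combinatorics.\<close> Exhausting the tree by subtrees, each vertex that is added has exactly one
  neighbour in the subtree reached so far, for two neighbours would close a cycle
  (\<open>subtree_unique_neighbour\<close>).  This yields the leaf-by-leaf presentation, and at the same time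
  allows a sign to be chosen for each vertex such that, after replacing some of the generators of the
  group by their inverses, the two exponents of each relation have the same sign
  (\<open>subtree_presentation\<close>).  A relation with two negative exponents is equivalent to its inverse, so
  the tree product is the enveloping group of the positive monoid.
\<close>

section \<open>Words and divisibility\<close>

lemma presentation_cong_mono:
  assumes "(u, v) \<in> presentation_cong S R" "S \<subseteq> S'" "R \<subseteq> R'"
  shows "(u, v) \<in> presentation_cong S' R'"
  using assms(1)
proof (induction rule: presentation_cong.induct)
  case (trans u v w)
  then show ?case using presentation_cong.trans by fast
next
  case (sym u v)
  then show ?case using presentation_cong.sym by fast
next
  case (rel l r u v)
  then show ?case using assms(2,3) lists_mono by (blast intro: presentation_cong.rel)
next
  case (refl w)
  then show ?case using assms(2) lists_mono by (blast intro: presentation_cong.refl)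
qed

locale presentation =
  fixes S :: "'a set" and R :: "('a list \<times> 'a list) set"
  assumes relations_words: "R \<subseteq> lists S \<times> lists S"
begin

abbreviation equivalent (infix "\<approx>" 50) where
  "u \<approx> v \<equiv> (u, v) \<in> presentation_cong S R"

lemma equivalent_words: "u \<approx> v \<Longrightarrow> u \<in> lists S \<and> v \<in> lists S"
  by (induction rule: presentation_cong.induct) (use relations_words in auto)

lemmas equivalent_refl [simp] = presentation_cong.refl [of _ S R]
lemmas equivalent_sym = presentation_cong.sym [of _ _ S R]
lemmas equivalent_trans [trans] = presentation_cong.trans [of _ _ S R]

lemma equivalent_relation: "(l, r) \<in> R \<Longrightarrow> l \<approx> r"
  using presentation_cong.rel [of l r R "[]" S "[]"] by simp

lemma equivalent_context:
  "u \<approx> v \<Longrightarrow> p \<in> lists S \<Longrightarrow> q \<in> lists S \<Longrightarrow> p @ u @ q \<approx> p @ v @ q"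
proof (induction rule: presentation_cong.induct)
  case (rel l r u v)
  then show ?case
    using presentation_cong.rel [of l r R "p @ u" S "v @ q"] by simp
next
  case (sym v w)
  then show ?case using equivalent_sym by blast
next
  case (trans u v w)
  then show ?case using equivalent_trans by blast
qed simp

lemma equivalent_append: "u \<approx> v \<Longrightarrow> u' \<approx> v' \<Longrightarrow> u @ u' \<approx> v @ v'"
  using equivalent_context [of u v "[]" u'] equivalent_context [of u' v' v "[]"]
    equivalent_words equivalent_trans by (metis append_Nil append_Nil2 lists.Nil)

lemma equivalent_append_left: "u \<approx> v \<Longrightarrow> p \<in> lists S \<Longrightarrow> p @ u \<approx> p @ v"
  using equivalent_context [of u v p "[]"] by simp

lemma equivalent_append_right: "u \<approx> v \<Longrightarrow> p \<in> lists S \<Longrightarrow> u @ p \<approx> v @ p"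
  using equivalent_context [of u v "[]" p] by simp

lemma equivalent_Cons: "u \<approx> v \<Longrightarrow> a \<in> S \<Longrightarrow> a # u \<approx> a # v"
  using equivalent_append_left [of u v "[a]"] by simp

lemma equiv_equivalent: "equiv (lists S) (presentation_cong S R)"
  by (intro equivI refl_onI symI transI)
    (auto dest: equivalent_words intro: equivalent_sym, metis equivalent_trans)

definition left_dvd (infix "\<preceq>" 50) where
  "u \<preceq> v \<longleftrightarrow> (\<exists>w. v \<approx> u @ w)"

lemma left_dvd_words: "u \<preceq> v \<Longrightarrow> u \<in> lists S \<and> v \<in> lists S"
  unfolding left_dvd_def using equivalent_words by force

lemma left_dvdE:
  assumes "u \<preceq> v" obtains w where "w \<in> lists S" "v \<approx> u @ w"
  using assms unfolding left_dvd_def using equivalent_words by force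

lemma left_dvd_append [simp]: "u \<in> lists S \<Longrightarrow> v \<in> lists S \<Longrightarrow> u \<preceq> u @ v"
  unfolding left_dvd_def by (metis append_in_lists_conv equivalent_refl)

lemma left_dvd_equivalent: "u \<approx> v \<Longrightarrow> u \<preceq> v"
  unfolding left_dvd_def using equivalent_sym by (metis append_Nil2)

lemma left_dvd_refl [simp]: "u \<in> lists S \<Longrightarrow> u \<preceq> u"
  by (simp add: left_dvd_equivalent)

lemma left_dvd_trans [trans]: "u \<preceq> v \<Longrightarrow> v \<preceq> w \<Longrightarrow> u \<preceq> w"
proof -
  assume "u \<preceq> v" "v \<preceq> w"
  then obtain p q where "v \<approx> u @ p" "p \<in> lists S" "w \<approx> v @ q" "q \<in> lists S"
    by (meson left_dvdE)
  then have "w \<approx> u @ p @ q"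
    using equivalent_append_right [of v "u @ p" q] equivalent_trans by fastforce
  then show "u \<preceq> w" unfolding left_dvd_def by blast
qed

lemma left_dvd_context: "u \<preceq> v \<Longrightarrow> p \<in> lists S \<Longrightarrow> p @ u \<preceq> p @ v"
  unfolding left_dvd_def using equivalent_append_left by fastforce

lemma left_dvd_Cons: "u \<preceq> v \<Longrightarrow> a \<in> S \<Longrightarrow> a # u \<preceq> a # v"
  using left_dvd_context [of u v "[a]"] by simp

definition right_lcm where
  "right_lcm u v c \<longleftrightarrow> u \<preceq> c \<and> v \<preceq> c \<and> (\<forall>d. u \<preceq> d \<and> v \<preceq> d \<longrightarrow> c \<preceq> d)"

lemma right_lcm_Nil: "u \<in> lists S \<Longrightarrow> right_lcm [] u u" "u \<in> lists S \<Longrightarrow> right_lcm u [] u"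
  unfolding right_lcm_def using left_dvd_append [of "[]" u] by auto

text \<open>
  Elements of the presented monoid are handled through a canonical word in each class, so that
  normal forms are plain words and their equality is equality of elements.
\<close>

definition representative where "representative u = (SOME v. u \<approx> v)"

lemma equivalent_representative: "u \<in> lists S \<Longrightarrow> u \<approx> representative u"
  unfolding representative_def using equivalent_refl by (rule someI)

lemma representative_cong: "u \<approx> v \<Longrightarrow> representative u = representative v"
  unfolding representative_def by (meson equivalent_sym equivalent_trans)

end

text \<open>
  A weight that respects the relations makes proper divisibility well-founded: division by a
  nonempty word lowers the weight, and only the empty word represents the unit.
\<close>

locale homogeneous_presentation = presentation +
  assumes weight_exists: "\<exists>f :: 'a \<Rightarrow> nat. (\<forall>a \<in> S. 0 < f a) \<and>
    (\<forall>(l, r) \<in> R. sum_list (map f l) = sum_list (map f r))"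
begin

definition letter_weight :: "'a \<Rightarrow> nat" where
  "letter_weight = (SOME f. (\<forall>a \<in> S. 0 < f a) \<and>
    (\<forall>(l, r) \<in> R. sum_list (map f l) = sum_list (map f r)))"

definition weight :: "'a list \<Rightarrow> nat" where
  "weight w = sum_list (map letter_weight w)"

lemma letter_weight_pos: "a \<in> S \<Longrightarrow> 0 < letter_weight a"
  and weight_relation: "(l, r) \<in> R \<Longrightarrow> weight l = weight r"
  using someI_ex [OF weight_exists] unfolding letter_weight_def [symmetric] weight_def by auto

lemma weight_append [simp]: "weight (u @ v) = weight u + weight v"
  by (simp add: weight_def)

lemma weight_Nil [simp]: "weight [] = 0"
  by (simp add: weight_def)

lemma length_le_weight: "w \<in> lists S \<Longrightarrow> length w \<le> weight w"
  by (induction w) (auto simp: weight_def dest: letter_weight_pos)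

lemma weight_pos: "w \<in> lists S \<Longrightarrow> w \<noteq> [] \<Longrightarrow> 0 < weight w"
  using length_le_weight [of w] by (cases w) auto

lemma weight_Cons_less: "a \<in> S \<Longrightarrow> weight w < weight (a # w)"
  using weight_append [of "[a]" w] weight_pos [of "[a]"] by simp

lemma weight_equivalent: "u \<approx> v \<Longrightarrow> weight u = weight v"
proof (induction rule: presentation_cong.induct)
  case (rel l r u v)
  then show ?case by (simp add: weight_relation)
qed auto

lemma equivalent_Nil [simp]: "u \<approx> [] \<longleftrightarrow> u = []" "[] \<approx> u \<longleftrightarrow> u = []"
  using weight_equivalent weight_pos equivalent_words weight_Nil
  by (metis equivalent_refl lists.Nil not_less_zero)+

lemma left_dvd_Nil [simp]: "u \<preceq> [] \<longleftrightarrow> u = []"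
  unfolding left_dvd_def by auto

lemma representative_Nil [simp]: "representative [] = []"
  using equivalent_representative [of "[]"] by simp

lemma left_dvd_weight: "u \<preceq> v \<Longrightarrow> weight u \<le> weight v"
  unfolding left_dvd_def using weight_equivalent by fastforce

end

locale left_cancellative_presentation = homogeneous_presentation +
  assumes left_cancel_letter: "a # u \<approx> a # v \<Longrightarrow> u \<approx> v"
begin

lemma left_cancel: "p @ u \<approx> p @ v \<Longrightarrow> u \<approx> v"
  by (induction p) (auto dest: left_cancel_letter)

lemma left_dvd_cancel: "p @ u \<preceq> p @ v \<Longrightarrow> u \<preceq> v"
  unfolding left_dvd_def using left_cancel by fastforce

lemma left_dvd_cancel_letter: "a # u \<preceq> a # v \<Longrightarrow> u \<preceq> v"
  using left_dvd_cancel [of "[a]"] by simp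

text \<open>
  Left cancellation transports lcms: multiples of \<open>a u\<close> and \<open>a v\<close> are \<open>a\<close> times multiples of \<open>u\<close>
  and \<open>v\<close>.
\<close>

lemma right_lcm_Cons:
  assumes "right_lcm u v c" "a \<in> S"
  shows "right_lcm (a # u) (a # v) (a # c)"
  unfolding right_lcm_def
proof (intro conjI allI impI)
  fix d assume d: "a # u \<preceq> d \<and> a # v \<preceq> d"
  then obtain p where p: "d \<approx> a # u @ p" by (auto elim: left_dvdE)
  with d have "a # u \<preceq> a # u @ p" "a # v \<preceq> a # u @ p"
    by (meson left_dvd_equivalent left_dvd_trans)+
  then have "c \<preceq> u @ p"
    using assms(1) left_dvd_cancel_letter unfolding right_lcm_def by blast
  then have "a # c \<preceq> a # u @ p" using assms(2) by (rule left_dvd_Cons)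
  then show "a # c \<preceq> d"
    using p equivalent_sym left_dvd_equivalent left_dvd_trans by blast
qed (use assms left_dvd_Cons in \<open>auto simp: right_lcm_def\<close>)

lemma left_dvd_ConsE:
  assumes "a # u \<preceq> w"
  obtains v where "w \<approx> a # v" "u \<preceq> v" "weight v < weight w"
proof -
  obtain p where p: "p \<in> lists S" "w \<approx> (a # u) @ p" using assms by (rule left_dvdE)
  then have "a # u @ p \<in> lists S" using equivalent_words by fastforce
  then have "u \<preceq> u @ p" "weight (u @ p) < weight w"
    using p weight_equivalent weight_Cons_less [of a "u @ p"] by auto
  then show ?thesis using that p by auto
qed

text \<open>
  This is the local criterion of Bjoerner, Edelman and Ziegler for a bounded finite poset to be a lattice,
  applied to the divisors of \<open>w\<close>: it suffices that any two covers of an element have a join, and by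
  left cancellation the join of the covers \<open>z a\<close> and \<open>z b\<close> is \<open>z\<close> times the lcm of the letters \<open>a\<close> and \<open>b\<close>.
  For \<open>u = a u'\<close> and \<open>v = b v'\<close> the lcm is assembled from that of \<open>u\<close> and \<open>b\<close> and that of \<open>a\<close> and
  \<open>v\<close>.  Each lcm formed on the way is one of words with a common first letter, and removing this letter
  reduces it to divisors of a word lighter than \<open>w\<close>.
\<close>

lemma right_lcm_if_letters:
  assumes letters: "\<And>a b. a \<in> S \<Longrightarrow> b \<in> S \<Longrightarrow> \<exists>c. right_lcm [a] [b] c"
  shows "u \<preceq> w \<Longrightarrow> v \<preceq> w \<Longrightarrow> \<exists>c. right_lcm u v c"
proof (induction "weight w" arbitrary: u v w rule: less_induct)
  case less
  note uw = less.prems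
  show ?case
  proof (cases "u = [] \<or> v = []")
    case True
    then show ?thesis using right_lcm_Nil left_dvd_words uw by metis
  next
    case False
    then obtain a u' b v' where u: "u = a # u'" and v: "v = b # v'"
      by (meson list.exhaust)
    have ab: "a \<in> S" "b \<in> S" "u' \<in> lists S" "v' \<in> lists S"
      using left_dvd_words [OF uw(1)] left_dvd_words [OF uw(2)] unfolding u v by auto
    have au: "[a] \<preceq> u" and bv: "[b] \<preceq> v"
      using left_dvd_append [of "[a]" u'] left_dvd_append [of "[b]" v'] ab u v by auto
    \<comment> \<open>The words \<open>a p\<close> and \<open>b q\<close> both represent the lcm of \<open>a\<close> and \<open>b\<close>.\<close>
    obtain e where e: "right_lcm [a] [b] e" using letters ab by blast
    then obtain p q where p: "e \<approx> a # p" and q: "e \<approx> b # q"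
      unfolding right_lcm_def by (auto elim!: left_dvdE)
    have ew: "e \<preceq> z" if "u \<preceq> z" "v \<preceq> z" for z
      using e that au bv left_dvd_trans unfolding right_lcm_def by blast
    have ap: "a # p \<preceq> z" "b # q \<preceq> z" if "u \<preceq> z" "v \<preceq> z" for z
      using ew [OF that] p q equivalent_sym left_dvd_equivalent left_dvd_trans by blast+
    obtain w1 where w1: "w \<approx> a # w1" "u' \<preceq> w1" "weight w1 < weight w"
      using uw(1) left_dvd_ConsE unfolding u by blast
    obtain w2 where w2: "w \<approx> b # w2" "v' \<preceq> w2" "weight w2 < weight w"
      using uw(2) left_dvd_ConsE unfolding v by blast
    have below_w1: "y \<preceq> w1" if "a # y \<preceq> w" for y
      using that w1(1) left_dvd_equivalent left_dvd_trans left_dvd_cancel_letter by blast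
    have below_w2: "y \<preceq> w2" if "b # y \<preceq> w" for y
      using that w2(1) left_dvd_equivalent left_dvd_trans left_dvd_cancel_letter by blast
    \<comment> \<open>The lcm \<open>a c1\<close> of \<open>u\<close> and \<open>b\<close>, and then the lcm \<open>b c2\<close> of \<open>a\<close> and \<open>v\<close>.\<close>
    obtain c1 where "right_lcm u' p c1"
      using less.hyps [OF w1(3) w1(2)] below_w1 ap uw by blast
    then have c1: "right_lcm u (a # p) (a # c1)" using right_lcm_Cons ab u by blast
    obtain c2 where "right_lcm v' q c2"
      using less.hyps [OF w2(3) w2(2)] below_w2 ap uw by blast
    then have c2: "right_lcm v (b # q) (b # c2)" using right_lcm_Cons ab v by blast
    \<comment> \<open>Rewritten with first letter \<open>a\<close>, as \<open>a c3\<close>, the second lcm can be joined with the first.\<close>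
    have "[a] \<preceq> b # c2"
    proof -
      have "[a] \<preceq> e" "e \<preceq> b # q" "b # q \<preceq> b # c2"
        using e c2 q left_dvd_equivalent unfolding right_lcm_def by auto
      then show ?thesis using left_dvd_trans by blast
    qed
    then obtain c3 where c3: "b # c2 \<approx> a # c3" by (auto elim: left_dvdE)
    have c13: "a # c1 \<preceq> z" "a # c3 \<preceq> z" if "u \<preceq> z" "v \<preceq> z" for z
    proof -
      show "a # c1 \<preceq> z" using c1 ap that unfolding right_lcm_def by blast
      have "b # c2 \<preceq> z" using c2 ap that unfolding right_lcm_def by blast
      then show "a # c3 \<preceq> z"
        using c3 equivalent_sym left_dvd_equivalent left_dvd_trans by blast
    qed
    obtain d where d: "right_lcm c1 c3 d"
      using less.hyps [OF w1(3)] below_w1 c13 uw by blast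
    then have d: "right_lcm (a # c1) (a # c3) (a # d)" using right_lcm_Cons ab by blast
    have "right_lcm u v (a # d)"
      unfolding right_lcm_def
    proof (intro conjI allI impI)
      show "u \<preceq> a # d" using c1 d left_dvd_trans unfolding right_lcm_def by blast
      have "v \<preceq> b # c2" "b # c2 \<preceq> a # c3" "a # c3 \<preceq> a # d"
        using c2 d c3 left_dvd_equivalent unfolding right_lcm_def by blast+
      then show "v \<preceq> a # d" using left_dvd_trans by blast
    next
      fix z assume "u \<preceq> z \<and> v \<preceq> z"
      then show "a # d \<preceq> z" using d c13 unfolding right_lcm_def by blast
    qed
    then show ?thesis ..
  qed
qed

text \<open>
  This and the uniqueness of the decomposition say that the monoid is free under left multiplication
  by the powers of \<open>z\<close>, with the elements that \<open>z\<close> does not divide as a basis.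
\<close>

lemma power_decomposition:
  assumes "z \<in> lists S" "z \<noteq> []"
  shows "u \<in> lists S \<Longrightarrow> \<exists>k v. \<not> z \<preceq> v \<and> u \<approx> concat (replicate k z) @ v"
proof (induction "weight u" arbitrary: u rule: less_induct)
  case less
  show ?case
  proof (cases "z \<preceq> u")
    case False
    then show ?thesis using less.prems by (intro exI [of _ 0] exI [of _ u]) auto
  next
    case True
    then obtain u' where u': "u' \<in> lists S" "u \<approx> z @ u'" by (rule left_dvdE)
    then have "weight u' < weight u"
      using weight_equivalent [of u "z @ u'"] weight_pos [of z] assms by auto
    then obtain k v where "\<not> z \<preceq> v" and kv: "u' \<approx> concat (replicate k z) @ v"
      using less.hyps u' by blast
    moreover have "u \<approx> concat (replicate (Suc k) z) @ v"
      using equivalent_trans [OF u'(2)] equivalent_append_left [OF kv assms(1)] by simp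
    ultimately show ?thesis by blast
  qed
qed

lemma power_decomposition_unique:
  assumes "concat (replicate k z) @ v \<approx> concat (replicate k' z) @ v'"
    and "\<not> z \<preceq> v" "\<not> z \<preceq> v'"
  shows "k = k' \<and> v \<approx> v'"
proof -
  have *: "False" if "concat (replicate k z) @ v \<approx> concat (replicate k' z) @ v'"
    "\<not> z \<preceq> v" "k < k'" for k k' v v'
  proof -
    obtain d where "k' = k + Suc d" using \<open>k < k'\<close> less_imp_Suc_add by auto
    then have "concat (replicate k' z) = concat (replicate k z) @ z @ concat (replicate d z)"
      unfolding \<open>k' = k + Suc d\<close> replicate_add by simp
    then have "v \<approx> z @ concat (replicate d z) @ v'"
      using that(1) left_cancel by simp
    then show False using that(2) unfolding left_dvd_def by blast
  qed
  have "k = k'" using *[OF assms(1,2)] *[OF equivalent_sym [OF assms(1)] assms(3)]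
    by (meson linorder_neqE_nat)
  then show ?thesis using assms(1) left_cancel by blast
qed

end

text \<open>
  Words are mostly treated as opaque below; these rules would break membership in a set of words
  into statements on single letters.
\<close>

declare in_listsI [rule del] in_listsD [rule del]

section \<open>Amalgamated products\<close>

text \<open>
  The two factors are indexed by truth values so that each argument about normal forms is made once for
  both.  The amalgam identifies the word \<open>x True\<close> of the first factor with the word \<open>x False\<close> of the
  second.
\<close>

locale amalgam =
  fixes S :: "bool \<Rightarrow> 'a set" and R :: "bool \<Rightarrow> ('a list \<times> 'a list) set"
    and x :: "bool \<Rightarrow> 'a list"
  assumes factor: "left_cancellative_presentation (S i) (R i)"
    and disjoint: "S True \<inter> S False = {}"
    and x_words: "x i \<in> lists (S i)" and x_nontrivial: "x i \<noteq> []"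
begin

definition "all_letters = S True \<union> S False"
definition "all_relations = insert (x True, x False) (R True \<union> R False)"

sublocale factor: left_cancellative_presentation "S i" "R i" for i
  by (rule factor)

lemma letters_subset: "S i \<subseteq> all_letters"
  unfolding all_letters_def by (cases i) auto

lemma words_subset: "u \<in> lists (S i) \<Longrightarrow> u \<in> lists all_letters"
  using letters_subset by (meson lists_mono subsetD)

lemma relations_subset: "R i \<subseteq> all_relations"
  unfolding all_relations_def by (cases i) auto

sublocale amalgam: presentation all_letters all_relations
proof
  have "R i \<subseteq> lists all_letters \<times> lists all_letters" for i
    using factor.relations_words [of i] words_subset by blast
  moreover have "x i \<in> lists all_letters" for i
    using x_words words_subset by blast
  ultimately show "all_relations \<subseteq> lists all_letters \<times> lists all_letters"
    unfolding all_relations_def by blast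
qed

abbreviation factor_equivalent ("_ \<approx>\<^bsub>_\<^esub> _" [51, 0, 51] 50) where
  "u \<approx>\<^bsub>i\<^esub> v \<equiv> (u, v) \<in> presentation_cong (S i) (R i)"

abbreviation amalgam_equivalent (infix "\<simeq>" 50) where
  "u \<simeq> v \<equiv> (u, v) \<in> presentation_cong all_letters all_relations"

abbreviation x_power :: "bool \<Rightarrow> nat \<Rightarrow> 'a list" where
  "x_power i k \<equiv> concat (replicate k (x i))"

lemma x_power_words: "x_power i k \<in> lists (S i)"
  using x_words by (induction k) auto

lemma factor_imp_amalgam: "u \<approx>\<^bsub>i\<^esub> v \<Longrightarrow> u \<simeq> v"
  by (rule presentation_cong_mono [OF _ letters_subset relations_subset])

lemma x_equivalent: "x i \<simeq> x j"
proof -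
  have "x True \<simeq> x False"
    by (rule amalgam.equivalent_relation) (simp add: all_relations_def)
  moreover have "x i \<simeq> x i"
    using x_words words_subset by (blast intro: presentation_cong.refl)
  ultimately show ?thesis using amalgam.equivalent_sym by (cases i; cases j) auto
qed

lemma x_power_equivalent: "x_power i k \<simeq> x_power j k"
  by (induction k) (auto intro: amalgam.equivalent_append x_equivalent)

text \<open>
  The reduced words are the basis of a factor over the powers of \<open>x i\<close>, one canonical word for each
  element.
\<close>

definition reduced :: "bool \<Rightarrow> 'a list \<Rightarrow> bool" where
  "reduced i w \<longleftrightarrow> w \<in> lists (S i) \<and> factor.representative i w = w \<and> \<not> factor.left_dvd i (x i) w"

lemma reduced_Nil: "reduced i []"
  unfolding reduced_def using x_nontrivial by simp

definition decompose :: "bool \<Rightarrow> 'a list \<Rightarrow> nat \<times> 'a list" where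
  "decompose i m = (SOME (k, w). reduced i w \<and> m \<approx>\<^bsub>i\<^esub> x_power i k @ w)"

lemma reduced_unique:
  assumes "reduced i w" "reduced i w'" "x_power i k @ w \<approx>\<^bsub>i\<^esub> x_power i k' @ w'"
  shows "k = k' \<and> w = w'"
  using assms factor.power_decomposition_unique factor.representative_cong
  unfolding reduced_def by metis

lemma decompose_eqI:
  assumes "reduced i w" "m \<approx>\<^bsub>i\<^esub> x_power i k @ w"
  shows "decompose i m = (k, w)"
  unfolding decompose_def
proof (rule some_equality)
  fix p assume "case p of (k, w) \<Rightarrow> reduced i w \<and> m \<approx>\<^bsub>i\<^esub> x_power i k @ w"
  then obtain k' w' where p: "p = (k', w')" "reduced i w'" "m \<approx>\<^bsub>i\<^esub> x_power i k' @ w'"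
    by (cases p) simp
  then have "x_power i k' @ w' \<approx>\<^bsub>i\<^esub> x_power i k @ w"
    using assms(2) factor.equivalent_sym factor.equivalent_trans by blast
  then show "p = (k, w)" using reduced_unique p assms(1) by simp
qed (use assms in auto)

lemma decomposeE:
  assumes "m \<in> lists (S i)"
  obtains k w where "reduced i w" "m \<approx>\<^bsub>i\<^esub> x_power i k @ w" "decompose i m = (k, w)"
proof -
  obtain k v where kv: "\<not> factor.left_dvd i (x i) v" "m \<approx>\<^bsub>i\<^esub> x_power i k @ v"
    using factor.power_decomposition [OF x_words x_nontrivial assms] by blast
  have v: "v \<in> lists (S i)" using factor.equivalent_words [OF kv(2)] by simp
  let ?w = "factor.representative i v"
  have vw: "v \<approx>\<^bsub>i\<^esub> ?w" using v by (rule factor.equivalent_representative)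
  have "\<not> factor.left_dvd i (x i) ?w"
    using kv(1) vw factor.left_dvd_trans factor.left_dvd_equivalent factor.equivalent_sym by blast
  then have w: "reduced i ?w"
    unfolding reduced_def
    using vw factor.equivalent_words factor.representative_cong by metis
  have "m \<approx>\<^bsub>i\<^esub> x_power i k @ ?w"
    using kv(2) vw x_power_words factor.equivalent_append_left factor.equivalent_trans by blast
  then show ?thesis using w that decompose_eqI by blast
qed

lemma decompose_cong:
  assumes "m \<approx>\<^bsub>i\<^esub> m'" shows "decompose i m = decompose i m'"
proof -
  have m': "m' \<in> lists (S i)" using assms factor.equivalent_words by blast
  obtain k w where "reduced i w" "m' \<approx>\<^bsub>i\<^esub> x_power i k @ w" "decompose i m' = (k, w)"
    using m' by (rule decomposeE)
  then show ?thesis using assms decompose_eqI factor.equivalent_trans by metis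
qed

text \<open>
  A normal form is a pair of an exponent \<open>k\<close>, for the leading power of \<open>x\<close>, and a list of nonempty
  reduced words alternating between the factors.
\<close>

definition syllables :: "(bool \<times> 'a list) list \<Rightarrow> bool" where
  "syllables ss \<longleftrightarrow> (\<forall>(i, w) \<in> set ss. reduced i w \<and> w \<noteq> []) \<and> distinct_adj (map fst ss)"

definition begins_with :: "bool \<Rightarrow> (bool \<times> 'a list) list \<Rightarrow> bool" where
  "begins_with i ss \<longleftrightarrow> ss \<noteq> [] \<and> fst (hd ss) = i"

definition normal_form :: "nat \<times> (bool \<times> 'a list) list \<Rightarrow> bool" where
  "normal_form st \<longleftrightarrow> syllables (snd st)"

text \<open>
  Seen from factor \<open>i\<close>, a normal form is an element of that factor followed by syllables that do not
  begin in it.  The passage to this view and the way back are inverse to each other, for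
  either factor; this is what allows both factors to act on the same set.
\<close>

definition split_head :: "bool \<Rightarrow> nat \<times> (bool \<times> 'a list) list \<Rightarrow> 'a list \<times> (bool \<times> 'a list) list" where
  "split_head i st = (if begins_with i (snd st)
     then (x_power i (fst st) @ snd (hd (snd st)), tl (snd st)) else (x_power i (fst st), snd st))"

definition attach :: "bool \<Rightarrow> 'a list \<times> (bool \<times> 'a list) list \<Rightarrow> nat \<times> (bool \<times> 'a list) list" where
  "attach i p = (case decompose i (fst p) of (k, w) \<Rightarrow>
     (k, if w = [] then snd p else (i, w) # snd p))"

lemma syllables_Cons:
  "syllables ((i, w) # ss) \<longleftrightarrow> reduced i w \<and> w \<noteq> [] \<and> \<not> begins_with i ss \<and> syllables ss"
  unfolding syllables_def begins_with_def by (cases ss) auto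

lemma split_head_syllables:
  assumes "normal_form st" "split_head i st = (m, ss)"
  shows "m \<in> lists (S i) \<and> syllables ss \<and> \<not> begins_with i ss"
proof (cases "begins_with i (snd st)")
  case True
  then obtain w ss' where "snd st = (i, w) # ss'"
    unfolding begins_with_def by (cases "snd st") auto
  with assms show ?thesis
    using x_power_words syllables_Cons True
    unfolding normal_form_def split_head_def reduced_def by auto
next
  case False
  with assms show ?thesis
    using x_power_words unfolding normal_form_def split_head_def by auto
qed

lemma attach_normal_form:
  assumes "m \<in> lists (S i)" "syllables ss" "\<not> begins_with i ss"
  shows "normal_form (attach i (m, ss))"
  using assms(1)
  by (rule decomposeE) (use assms syllables_Cons in \<open>auto simp: attach_def normal_form_def\<close>)

lemma attach_split_head:
  assumes "normal_form st" shows "attach i (split_head i st) = st"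
proof (cases "begins_with i (snd st)")
  case True
  then obtain w ss' where st: "snd st = (i, w) # ss'"
    unfolding begins_with_def by (cases "snd st") auto
  then have w: "reduced i w" "w \<noteq> []" using assms syllables_Cons unfolding normal_form_def by auto
  then have "decompose i (x_power i (fst st) @ w) = (fst st, w)"
    using x_power_words
    by (intro decompose_eqI presentation_cong.refl) (auto simp: reduced_def simp del: in_lists_conv_set)
  then show ?thesis
    using True st w unfolding split_head_def attach_def by (cases st) auto
next
  case False
  have "decompose i (x_power i (fst st)) = (fst st, [])"
    using x_power_words by (intro decompose_eqI reduced_Nil) (simp del: in_lists_conv_set)
  then show ?thesis using False unfolding split_head_def attach_def by (cases st) auto
qed

lemma split_head_attach:
  assumes "m \<in> lists (S i)" "\<not> begins_with i ss"
  shows "\<exists>m'. split_head i (attach i (m, ss)) = (m', ss) \<and> m \<approx>\<^bsub>i\<^esub> m'"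
  using assms(1)
proof (rule decomposeE)
  fix k w assume "m \<approx>\<^bsub>i\<^esub> x_power i k @ w" "decompose i m = (k, w)"
  then show ?thesis
    using assms(2) unfolding attach_def split_head_def by (auto simp: begins_with_def)
qed

lemma attach_cong: "m \<approx>\<^bsub>i\<^esub> m' \<Longrightarrow> attach i (m, ss) = attach i (m', ss)"
  unfolding attach_def fst_conv snd_conv by (drule decompose_cong) simp

text \<open>
  Factor \<open>i\<close> acts by left multiplication on the first component of its view of a normal form, hence
  freely.
\<close>

definition act :: "bool \<Rightarrow> 'a list \<Rightarrow> nat \<times> (bool \<times> 'a list) list \<Rightarrow> nat \<times> (bool \<times> 'a list) list" where
  "act i u st = attach i (apfst ((@) u) (split_head i st))"

lemma act_cong:
  assumes "u \<approx>\<^bsub>i\<^esub> v" "normal_form st" shows "act i u st = act i v st"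
proof -
  obtain m ss where "split_head i st = (m, ss)" by fastforce
  then show ?thesis
    using assms split_head_syllables factor.equivalent_append_right attach_cong
    unfolding act_def by auto
qed

lemma act_normal_form:
  assumes "u \<in> lists (S i)" "normal_form st" shows "normal_form (act i u st)"
proof -
  obtain m ss where "split_head i st = (m, ss)" by fastforce
  then show ?thesis
    using assms split_head_syllables attach_normal_form [of "u @ m" i ss]
    unfolding act_def by auto
qed

lemma act_append:
  assumes "u \<in> lists (S i)" "v \<in> lists (S i)" "normal_form st"
  shows "act i (u @ v) st = act i u (act i v st)"
proof -
  obtain m ss where m: "split_head i st = (m, ss)" by fastforce
  with assms have ss: "m \<in> lists (S i)" "\<not> begins_with i ss"
    using split_head_syllables by blast+
  then obtain m' where m': "split_head i (attach i (v @ m, ss)) = (m', ss)" "v @ m \<approx>\<^bsub>i\<^esub> m'"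
    using split_head_attach [of "v @ m" i ss] assms by auto
  show ?thesis
    unfolding act_def using m m' assms factor.equivalent_append_left [OF m'(2) assms(1)]
    by (auto simp: intro: attach_cong)
qed

lemma act_Nil: "normal_form st \<Longrightarrow> act i [] st = st"
  unfolding act_def by (simp add: attach_split_head apfst_def map_prod_def split_beta)

text \<open>
  In the view of either factor, multiplication by \<open>x\<close> just increases the leading exponent.  So the
  actions of the factors agree on the amalgamated submonoid and define one of the amalgam.
\<close>

lemma act_x:
  assumes "normal_form st" shows "act i (x i) st = (Suc (fst st), snd st)"
proof -
  have "split_head i (Suc (fst st), snd st) = apfst ((@) (x i)) (split_head i st)"
    unfolding split_head_def by simp
  then show ?thesis
    using attach_split_head [of "(Suc (fst st), snd st)" i] assms
    unfolding act_def normal_form_def by simp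
qed

lemma act_inj:
  assumes "act i u st = act i u st'" "u \<in> lists (S i)" "normal_form st" "normal_form st'"
  shows "st = st'"
proof -
  obtain m ss where m: "split_head i st = (m, ss)" by fastforce
  obtain m' ss' where m': "split_head i st' = (m', ss')" by fastforce
  note s = split_head_syllables [OF assms(3) m] split_head_syllables [OF assms(4) m']
  have "attach i (u @ m, ss) = attach i (u @ m', ss')"
    using assms(1) m m' unfolding act_def by simp
  moreover obtain n where n: "split_head i (attach i (u @ m, ss)) = (n, ss)" "u @ m \<approx>\<^bsub>i\<^esub> n"
    using split_head_attach [of "u @ m" i ss] s assms(2) by auto
  moreover obtain n' where n': "split_head i (attach i (u @ m', ss')) = (n', ss')" "u @ m' \<approx>\<^bsub>i\<^esub> n'"
    using split_head_attach [of "u @ m'" i ss'] s assms(2) by auto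
  ultimately have "ss = ss'" "n = n'" by auto
  then have "u @ m \<approx>\<^bsub>i\<^esub> u @ m'"
    using n(2) n'(2) factor.equivalent_trans factor.equivalent_sym by blast
  then have "attach i (m, ss) = attach i (m', ss')"
    using \<open>ss = ss'\<close> factor.left_cancel attach_cong by blast
  then show ?thesis using attach_split_head assms(3,4) m m' by metis
qed

definition side :: "'a \<Rightarrow> bool" where
  "side a \<longleftrightarrow> a \<in> S True"

lemma side_eq: "a \<in> S i \<Longrightarrow> side a = i"
  unfolding side_def using disjoint by (cases i) auto

lemma side_letter: "a \<in> all_letters \<Longrightarrow> a \<in> S (side a)"
  unfolding side_def all_letters_def by (cases "a \<in> S True") auto

definition word_act :: "'a list \<Rightarrow> nat \<times> (bool \<times> 'a list) list \<Rightarrow> nat \<times> (bool \<times> 'a list) list" where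
  "word_act u st = foldr (\<lambda>a. act (side a) [a]) u st"

lemma word_act_append: "word_act (u @ v) st = word_act u (word_act v st)"
  unfolding word_act_def by simp

lemma word_act_Cons: "word_act (a # u) st = act (side a) [a] (word_act u st)"
  unfolding word_act_def by simp

lemma word_act_normal_form:
  "u \<in> lists all_letters \<Longrightarrow> normal_form st \<Longrightarrow> normal_form (word_act u st)"
proof (induction u)
  case Nil
  then show ?case by (simp add: word_act_def)
next
  case (Cons a u)
  then show ?case using act_normal_form [of "[a]" "side a"] side_letter by (auto simp: word_act_Cons)
qed

lemma word_act_factor:
  "u \<in> lists (S i) \<Longrightarrow> normal_form st \<Longrightarrow> word_act u st = act i u st"
proof (induction u)
  case Nil
  then show ?case by (simp add: word_act_def act_Nil)
next
  case (Cons a u)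
  then show ?case using act_append [of "[a]" i u st] side_eq by (auto simp: word_act_Cons)
qed

lemma word_act_cong:
  "u \<simeq> v \<Longrightarrow> normal_form st \<Longrightarrow> word_act u st = word_act v st"
proof (induction arbitrary: st rule: presentation_cong.induct)
  case (rel l r u v)
  have v: "normal_form (word_act v st)" using rel word_act_normal_form by blast
  consider i where "(l, r) \<in> R i" | "l = x True" "r = x False"
    using rel unfolding all_relations_def by blast
  then have "word_act l (word_act v st) = word_act r (word_act v st)"
  proof cases
    case 1
    then show ?thesis
      using factor.equivalent_relation factor.equivalent_words word_act_factor act_cong v by metis
  next
    case 2
    then show ?thesis using word_act_factor [OF x_words v] act_x [OF v] by simp
  qed
  then show ?case by (simp add: word_act_append)
qed auto

definition syllables_word :: "(bool \<times> 'a list) list \<Rightarrow> 'a list" where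
  "syllables_word ss = concat (map snd ss)"

text \<open>
  The word that a normal form stands for.  Acting by \<open>u\<close> corresponds to prefixing \<open>u\<close> to this word, so
  a word is recovered, up to equivalence, from its action on the empty normal form.
\<close>

definition state_word :: "nat \<times> (bool \<times> 'a list) list \<Rightarrow> 'a list" where
  "state_word st = x_power True (fst st) @ syllables_word (snd st)"

lemma syllables_word_words: "syllables ss \<Longrightarrow> syllables_word ss \<in> lists all_letters"
proof (induction ss)
  case (Cons s ss)
  then show ?case
    using syllables_Cons [of "fst s" "snd s" ss] words_subset
    by (auto simp: syllables_word_def reduced_def)
qed (simp add: syllables_word_def)

lemma state_word_split_head:
  assumes "normal_form st" "split_head i st = (m, ss)"
  shows "state_word st \<simeq> m @ syllables_word ss"
proof -
  have "syllables_word (snd st) \<in> lists all_letters"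
    using assms syllables_word_words unfolding normal_form_def by blast
  then have "state_word st \<simeq> x_power i (fst st) @ syllables_word (snd st)"
    unfolding state_word_def by (intro amalgam.equivalent_append_right x_power_equivalent)
  moreover have "x_power i (fst st) @ syllables_word (snd st) = m @ syllables_word ss"
    using assms(2) unfolding split_head_def syllables_word_def begins_with_def
    by (cases "snd st = []"; cases "fst (hd (snd st)) = i"; cases "snd st") auto
  ultimately show ?thesis by simp
qed

lemma state_word_act:
  assumes "u \<in> lists (S i)" "normal_form st"
  shows "state_word (act i u st) \<simeq> u @ state_word st"
proof -
  obtain m ss where m: "split_head i st = (m, ss)" by fastforce
  note s = split_head_syllables [OF assms(2) m]
  obtain n where n: "split_head i (act i u st) = (n, ss)" "u @ m \<approx>\<^bsub>i\<^esub> n"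
    using split_head_attach [of "u @ m" i ss] s assms(1) m unfolding act_def by auto
  have "state_word (act i u st) \<simeq> n @ syllables_word ss"
    using n(1) act_normal_form assms state_word_split_head by blast
  also have "n @ syllables_word ss \<simeq> (u @ m) @ syllables_word ss"
    using factor_imp_amalgam [OF factor.equivalent_sym [OF n(2)]] s syllables_word_words
    by (intro amalgam.equivalent_append_right) auto
  also have "(u @ m) @ syllables_word ss \<simeq> u @ state_word st"
    using amalgam.equivalent_sym [OF amalgam.equivalent_append_left
        [OF state_word_split_head [OF assms(2) m] words_subset [OF assms(1)]]] by simp
  finally show ?thesis .
qed

definition normal :: "'a list \<Rightarrow> nat \<times> (bool \<times> 'a list) list" where
  "normal u = word_act u (0, [])"

lemma normal_form_empty: "normal_form (0, [])"
  unfolding normal_form_def syllables_def by simp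

lemma normal_form_normal: "u \<in> lists all_letters \<Longrightarrow> normal_form (normal u)"
  unfolding normal_def using word_act_normal_form normal_form_empty by blast

lemma normal_cong: "u \<simeq> v \<Longrightarrow> normal u = normal v"
  unfolding normal_def using word_act_cong normal_form_empty by blast

lemma state_word_normal: "u \<in> lists all_letters \<Longrightarrow> state_word (normal u) \<simeq> u"
proof (induction u)
  case Nil
  then show ?case by (simp add: normal_def word_act_def state_word_def syllables_word_def)
next
  case (Cons a u)
  then have a: "[a] \<in> lists (S (side a))" "a \<in> all_letters" "normal_form (normal u)"
    using side_letter normal_form_normal by auto
  have "state_word (normal (a # u)) \<simeq> [a] @ state_word (normal u)"
    using state_word_act [OF a(1,3)] unfolding normal_def word_act_Cons .
  also have "[a] @ state_word (normal u) \<simeq> [a] @ u"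
    using Cons a by (intro amalgam.equivalent_append_left) auto
  finally show ?case by simp
qed

text \<open>
  A single letter acts injectively, because the action of its factor is left multiplication in a left
  cancellative monoid.
\<close>

lemma left_cancel_amalgam:
  assumes "a # u \<simeq> a # v" shows "u \<simeq> v"
proof -
  have w: "a \<in> all_letters" "u \<in> lists all_letters" "v \<in> lists all_letters"
    using amalgam.equivalent_words [OF assms] by auto
  have "act (side a) [a] (normal u) = act (side a) [a] (normal v)"
    using normal_cong [OF assms] unfolding normal_def word_act_Cons .
  then have "normal u = normal v"
    using act_inj [of "side a" "[a]"] w side_letter normal_form_normal by auto
  then show ?thesis
    using state_word_normal w amalgam.equivalent_sym amalgam.equivalent_trans by metis
qed

text \<open>
  The action of \<open>u\<close> changes only the first component of the view from factor \<open>i\<close>, so \<open>u\<close> divides \<open>w\<close>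
  exactly if it divides this component inside the factor.
\<close>

lemma left_dvd_factor_iff:
  assumes "u \<in> lists (S i)" "w \<in> lists all_letters"
  shows "amalgam.left_dvd u w \<longleftrightarrow> factor.left_dvd i u (fst (split_head i (normal w)))"
proof -
  obtain m ss where m: "split_head i (normal w) = (m, ss)" by fastforce
  have nw: "normal_form (normal w)" using assms normal_form_normal by blast
  note s = split_head_syllables [OF nw m]
  have wm: "w \<simeq> m @ syllables_word ss"
    using state_word_split_head [OF nw m] state_word_normal [OF assms(2)]
      amalgam.equivalent_sym amalgam.equivalent_trans by blast
  show ?thesis
  proof
    assume "amalgam.left_dvd u w"
    then obtain v where v: "v \<in> lists all_letters" "w \<simeq> u @ v" by (rule amalgam.left_dvdE)
    then have nv: "normal_form (normal v)" using normal_form_normal by blast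
    have "normal w = act i u (normal v)"
      using normal_cong [OF v(2)] word_act_factor [OF assms(1) nv]
      unfolding normal_def word_act_append by simp
    moreover obtain n ss' where n: "split_head i (normal v) = (n, ss')" by fastforce
    moreover note split_head_syllables [OF nv n]
    ultimately have "u @ n \<approx>\<^bsub>i\<^esub> m"
      using split_head_attach [of "u @ n" i ss'] m assms(1) unfolding act_def by auto
    then show "factor.left_dvd i u (fst (split_head i (normal w)))"
      using m factor.equivalent_sym unfolding factor.left_dvd_def by auto
  next
    assume "factor.left_dvd i u (fst (split_head i (normal w)))"
    then obtain v where v: "v \<in> lists (S i)" "m \<approx>\<^bsub>i\<^esub> u @ v"
      using m by (auto elim: factor.left_dvdE simp del: in_lists_conv_set)
    then have "m @ syllables_word ss \<simeq> (u @ v) @ syllables_word ss"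
      using factor_imp_amalgam amalgam.equivalent_append_right s syllables_word_words by blast
    then show "amalgam.left_dvd u w"
      using amalgam.equivalent_trans [OF wm] unfolding amalgam.left_dvd_def by auto
  qed
qed

lemma factor_dvd_imp_amalgam: "factor.left_dvd i u v \<Longrightarrow> amalgam.left_dvd u v"
  unfolding factor.left_dvd_def amalgam.left_dvd_def using factor_imp_amalgam by blast

lemma right_lcm_factor:
  assumes "factor.right_lcm i u v c" shows "amalgam.right_lcm u v c"
  unfolding amalgam.right_lcm_def
proof (intro conjI allI impI)
  fix d assume d: "amalgam.left_dvd u d \<and> amalgam.left_dvd v d"
  have "u \<in> lists (S i)" "v \<in> lists (S i)" "c \<in> lists (S i)" "d \<in> lists all_letters"
    using assms d factor.left_dvd_words amalgam.left_dvd_words unfolding factor.right_lcm_def by blast+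
  then show "amalgam.left_dvd c d"
    using d assms left_dvd_factor_iff unfolding factor.right_lcm_def by blast
qed (use assms factor_dvd_imp_amalgam in \<open>auto simp: factor.right_lcm_def\<close>)

text \<open>
  The first syllable of the normal form of \<open>w\<close> lies in at most one factor.  For the other factor the
  leading component of \<open>w\<close> is a pure power of \<open>x\<close>; as it has a nontrivial divisor, the exponent is
  positive.
\<close>

lemma x_left_dvd:
  assumes "amalgam.left_dvd u w" "amalgam.left_dvd v w"
    and "u \<in> lists (S True)" "v \<in> lists (S False)" "u \<noteq> []" "v \<noteq> []"
  shows "amalgam.left_dvd (x i) w"
proof -
  have w: "w \<in> lists all_letters" using assms amalgam.left_dvd_words by blast
  let ?st = "normal w"
  obtain j y where j: "\<not> begins_with j (snd ?st)" and y: "y \<in> lists (S j)" "y \<noteq> []"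
    "amalgam.left_dvd y w"
    using assms unfolding begins_with_def by metis
  then have "factor.left_dvd j y (x_power j (fst ?st))"
    using left_dvd_factor_iff [OF y(1) w] unfolding split_head_def by simp
  then have "fst ?st \<noteq> 0" using y(2) by (intro notI) simp
  then obtain k where k: "fst ?st = Suc k" using not0_implies_Suc by blast
  have "split_head True ?st = apfst ((@) (x True)) (split_head True (k, snd ?st))"
    using k unfolding split_head_def by simp
  moreover have "normal_form (k, snd ?st)"
    using normal_form_normal [OF w] unfolding normal_form_def by simp
  ultimately have "factor.left_dvd True (x True) (fst (split_head True ?st))"
    using split_head_syllables [of "(k, snd ?st)" True] x_words
    by (cases "split_head True (k, snd ?st)") (auto simp del: in_lists_conv_set)
  then have "amalgam.left_dvd (x True) w" using left_dvd_factor_iff x_words w by blast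
  then show ?thesis
    using x_equivalent amalgam.left_dvd_equivalent amalgam.left_dvd_trans by blast
qed

text \<open>
  If \<open>b\<close> divides \<open>x\<close>, then a common multiple of \<open>a\<close> and \<open>b\<close> is the same as one of \<open>a\<close> and \<open>x\<close>, and
  those two lie in one factor.
\<close>

lemma right_lcm_mixed:
  assumes a: "a \<in> S True" and b: "factor.left_dvd False [b] (x False)"
    and e: "factor.right_lcm True [a] (x True) e"
  shows "amalgam.right_lcm [a] [b] e"
  unfolding amalgam.right_lcm_def
proof (intro conjI allI impI)
  have b': "[b] \<in> lists (S False)" using b factor.left_dvd_words by blast
  have e': "amalgam.right_lcm [a] (x True) e" using e by (rule right_lcm_factor)
  then show "amalgam.left_dvd [a] e" unfolding amalgam.right_lcm_def by blast
  have "amalgam.left_dvd [b] (x False)" "amalgam.left_dvd (x False) (x True)"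
    using b factor_dvd_imp_amalgam x_equivalent amalgam.left_dvd_equivalent by blast+
  then show "amalgam.left_dvd [b] e"
    using e' amalgam.left_dvd_trans unfolding amalgam.right_lcm_def by blast
  fix d assume "amalgam.left_dvd [a] d \<and> amalgam.left_dvd [b] d"
  moreover from this have "amalgam.left_dvd (x True) d"
    using x_left_dvd [of "[a]" d "[b]"] a b' by auto
  ultimately show "amalgam.left_dvd e d" using e' unfolding amalgam.right_lcm_def by blast
qed

lemma right_lcm_letters:
  assumes dvd: "\<And>b. b \<in> S False \<Longrightarrow> factor.left_dvd False [b] (x False)"
    and lcm: "\<And>i u v. u \<in> lists (S i) \<Longrightarrow> v \<in> lists (S i) \<Longrightarrow> \<exists>c. factor.right_lcm i u v c"
    and "a \<in> all_letters" "b \<in> all_letters"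
  shows "\<exists>c. amalgam.right_lcm [a] [b] c"
proof -
  have same: "\<exists>c. amalgam.right_lcm [a] [b] c" if "a \<in> S i" "b \<in> S i" for i a b
    using lcm [of "[a]" i "[b]"] that right_lcm_factor by (meson lists.Cons lists.Nil)
  have mixed: "\<exists>c. amalgam.right_lcm [a] [b] c" if "a \<in> S True" "b \<in> S False" for a b
    using lcm [of "[a]" True "x True"] that x_words right_lcm_mixed dvd
    by (meson lists.Cons lists.Nil)
  have "\<exists>c. amalgam.right_lcm [b] [a] c" if "a \<in> S True" "b \<in> S False" for a b
    using mixed [OF that] unfolding amalgam.right_lcm_def by blast
  then show ?thesis using same mixed assms(3,4) unfolding all_letters_def by blast
qed

end

section \<open>Garside monoids from presentations\<close>

lemma rev_in_lists [simp]: "rev u \<in> lists A \<longleftrightarrow> u \<in> lists A"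
  by (induction u) auto

context presentation
begin

lemma equivalent_power: "u \<approx> v \<Longrightarrow> concat (replicate k u) \<approx> concat (replicate k v)"
  by (induction k) (auto intro: equivalent_append)

lemma equivalent_central_power:
  assumes "\<And>a. a \<in> S \<Longrightarrow> a # z \<approx> z @ [a]" "z \<in> lists S" "u \<in> lists S"
  shows "u @ concat (replicate k z) \<approx> concat (replicate k z) @ u"
proof -
  have z: "w @ z \<approx> z @ w" if "w \<in> lists S" for w
    using that
  proof (induction w)
    case Nil
    then show ?case using assms(2) by simp
  next
    case (Cons a w)
    then have "a # w @ z \<approx> a # z @ w" by (intro equivalent_Cons) auto
    moreover have "a # z @ w \<approx> z @ a # w"
      using equivalent_append_right [OF assms(1), of a w] Cons by simp
    ultimately show ?case using equivalent_trans by simp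
  qed
  show ?thesis
  proof (induction k)
    case 0
    then show ?case using assms(3) by simp
  next
    case (Suc k)
    have "(u @ z) @ concat (replicate k z) \<approx> (z @ u) @ concat (replicate k z)"
      using z [OF assms(3)] equivalent_words [OF Suc] by (intro equivalent_append_right) auto
    moreover have "z @ u @ concat (replicate k z) \<approx> z @ concat (replicate k z) @ u"
      using Suc assms(2) by (intro equivalent_append_left)
    ultimately show ?case using equivalent_trans by simp
  qed
qed

text \<open>
  Each letter of \<open>u\<close> is absorbed by one copy of the central word \<open>z\<close>.
\<close>

lemma left_dvd_central_power:
  assumes "\<And>a. a \<in> S \<Longrightarrow> a # z \<approx> z @ [a]" "\<And>a. a \<in> S \<Longrightarrow> [a] \<preceq> z" "z \<in> lists S"
  shows "u \<in> lists S \<Longrightarrow> u \<preceq> concat (replicate (length u) z)"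
proof (induction u)
  case Nil
  then show ?case by simp
next
  case (Cons a u)
  let ?p = "concat (replicate (length u) z)"
  from Cons have u: "u \<preceq> ?p" "a \<in> S" by auto
  then have p: "?p \<in> lists S" using left_dvd_words by blast
  obtain w where w: "w \<in> lists S" "z \<approx> [a] @ w" using assms(2) u(2) by (meson left_dvdE)
  have "a # u \<preceq> a # ?p" using u by (rule left_dvd_Cons)
  also have "a # ?p \<preceq> (a # ?p) @ w" using u p w by (intro left_dvd_append) auto
  also have "(a # ?p) @ w \<preceq> a # w @ ?p"
    using equivalent_sym [OF equivalent_central_power [OF assms(1) assms(3) w(1)]] u(2)
    by (intro left_dvd_equivalent) (simp add: equivalent_Cons)
  also have "a # w @ ?p \<preceq> z @ ?p"
    using equivalent_append_right [OF equivalent_sym [OF w(2)] p] by (intro left_dvd_equivalent) simp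
  finally show ?case by simp
qed

lemma common_multiple_if_central:
  assumes "\<And>a. a \<in> S \<Longrightarrow> a # z \<approx> z @ [a]" "\<And>a. a \<in> S \<Longrightarrow> [a] \<preceq> z" "z \<in> lists S"
    and "u \<in> lists S" "v \<in> lists S"
  shows "\<exists>w. u \<preceq> w \<and> v \<preceq> w"
proof -
  let ?p = "\<lambda>k. concat (replicate k z)"
  have p: "?p k \<in> lists S" for k using assms(3) by (induction k) auto
  have "?p (length u) \<preceq> ?p (length u + length v)" "?p (length v) \<preceq> ?p (length v + length u)"
    using p by (simp_all add: replicate_add)
  then show ?thesis
    using left_dvd_central_power [OF assms(1-3)] assms(4,5) left_dvd_trans
    by (metis add.commute)
qed

lemma equivalent_rev:
  assumes "\<And>l r. (l, r) \<in> R \<Longrightarrow> (rev l, rev r) \<in> R"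
  shows "u \<approx> v \<Longrightarrow> rev u \<approx> rev v"
proof (induction rule: presentation_cong.induct)
  case (refl w)
  then show ?case by (intro presentation_cong.refl) auto
next
  case (sym v w)
  then show ?case using equivalent_sym by blast
next
  case (trans u v w)
  then show ?case using equivalent_trans by blast
next
  case (rel l r u v)
  then show ?case
    using presentation_cong.rel [of "rev l" "rev r" R "rev v" S "rev u"] assms by auto
qed

definition word_class where
  "word_class u = presentation_cong S R `` {u}"

lemma word_class_eq: "u \<in> lists S \<Longrightarrow> v \<in> lists S \<Longrightarrow> word_class u = word_class v \<longleftrightarrow> u \<approx> v"
  unfolding word_class_def using equiv_equivalent by (rule eq_equiv_class_iff)

lemma word_class_cong: "u \<approx> v \<Longrightarrow> word_class u = word_class v"
  using word_class_eq equivalent_words by blast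

lemma carrier_presented: "carrier (presented_monoid S R) = word_class ` lists S"
  unfolding presented_monoid_def quotient_def word_class_def by auto

lemma one_presented: "\<one>\<^bsub>presented_monoid S R\<^esub> = word_class []"
  unfolding presented_monoid_def word_class_def by simp

lemma mult_presented:
  assumes "u \<in> lists S" "v \<in> lists S"
  shows "word_class u \<otimes>\<^bsub>presented_monoid S R\<^esub> word_class v = word_class (u @ v)"
proof -
  have "word_class (p @ q) = word_class (u @ v)"
    if "p \<in> word_class u" "q \<in> word_class v" for p q
    using that equivalent_append equivalent_sym word_class_cong
    unfolding word_class_def by blast
  moreover have "u \<in> word_class u" "v \<in> word_class v"
    using assms unfolding word_class_def by simp_all
  ultimately have "(\<Union>p \<in> word_class u. \<Union>q \<in> word_class v. word_class (p @ q)) = word_class (u @ v)"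
    by blast
  then show ?thesis unfolding presented_monoid_def word_class_def by simp
qed

lemma monoid_presented: "monoid (presented_monoid S R)"
proof (rule monoidI)
  fix X Y Z
  assume "X \<in> carrier (presented_monoid S R)" "Y \<in> carrier (presented_monoid S R)"
    "Z \<in> carrier (presented_monoid S R)"
  then obtain u v w where "X = word_class u" "Y = word_class v" "Z = word_class w"
    "u \<in> lists S" "v \<in> lists S" "w \<in> lists S"
    unfolding carrier_presented by blast
  then show "(X \<otimes>\<^bsub>presented_monoid S R\<^esub> Y) \<otimes>\<^bsub>presented_monoid S R\<^esub> Z =
    X \<otimes>\<^bsub>presented_monoid S R\<^esub> (Y \<otimes>\<^bsub>presented_monoid S R\<^esub> Z)"
    by (simp add: mult_presented)
qed (auto simp: carrier_presented one_presented mult_presented intro!: imageI)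

lemma divides_presented:
  assumes "u \<in> lists S" "v \<in> lists S"
  shows "word_class u divides\<^bsub>presented_monoid S R\<^esub> word_class v \<longleftrightarrow> u \<preceq> v"
proof
  assume "word_class u divides\<^bsub>presented_monoid S R\<^esub> word_class v"
  then obtain w where "w \<in> lists S" "word_class v = word_class (u @ w)"
    unfolding factor_def carrier_presented using mult_presented assms by auto
  then show "u \<preceq> v"
    using word_class_eq assms unfolding left_dvd_def by (metis append_in_lists_conv)
next
  assume "u \<preceq> v"
  then obtain w where w: "w \<in> lists S" "v \<approx> u @ w" by (rule left_dvdE)
  then have "word_class v = word_class u \<otimes>\<^bsub>presented_monoid S R\<^esub> word_class w"
    using mult_presented assms word_class_cong by simp
  then show "word_class u divides\<^bsub>presented_monoid S R\<^esub> word_class v"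
    unfolding factor_def carrier_presented using w by blast
qed

end

text \<open>
  Relations that are stable under reversal make reversal of words an anti-automorphism of the
  presented monoid, so that every statement on the left has its mirror image on the right.
\<close>

locale reversible_presentation = left_cancellative_presentation +
  assumes relations_rev: "(l, r) \<in> R \<Longrightarrow> (rev l, rev r) \<in> R"
begin

lemma equivalent_rev_iff: "rev u \<approx> rev v \<longleftrightarrow> u \<approx> v"
  using equivalent_rev [OF relations_rev] by (metis rev_rev_ident)

lemma right_cancel: "u @ p \<approx> v @ p \<Longrightarrow> u \<approx> v"
  using equivalent_rev_iff [of "u @ p" "v @ p"] equivalent_rev_iff [of u v]
    left_cancel [of "rev p" "rev u" "rev v"] by simp

lemma right_divides_presented:
  assumes "u \<in> lists S" "v \<in> lists S"
  shows "right_divides (presented_monoid S R) (word_class u) (word_class v) \<longleftrightarrow> rev u \<preceq> rev v"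
proof
  assume "right_divides (presented_monoid S R) (word_class u) (word_class v)"
  then obtain w where "w \<in> lists S" "word_class v = word_class (w @ u)"
    unfolding right_divides_def carrier_presented using mult_presented assms by auto
  then have "v \<approx> w @ u" using word_class_eq assms by (metis append_in_lists_conv)
  then have "rev v \<approx> rev u @ rev w" using equivalent_rev_iff [of v "w @ u"] by simp
  then show "rev u \<preceq> rev v" unfolding left_dvd_def by blast
next
  assume "rev u \<preceq> rev v"
  then obtain w where w: "w \<in> lists S" "rev v \<approx> rev u @ w" by (rule left_dvdE)
  then have "v \<approx> rev w @ u" using equivalent_rev_iff [of v "rev w @ u"] by simp
  then have "word_class v = word_class (rev w) \<otimes>\<^bsub>presented_monoid S R\<^esub> word_class u"
    using mult_presented [of "rev w" u] assms word_class_cong w by auto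
  then show "right_divides (presented_monoid S R) (word_class u) (word_class v)"
    unfolding right_divides_def carrier_presented using w by (metis imageI rev_in_lists)
qed

lemma monoid_cancel_presented: "monoid_cancel (presented_monoid S R)"
proof (intro monoid_cancel.intro monoid_presented monoid_cancel_axioms.intro)
  fix X Y Z
  assume "X \<in> carrier (presented_monoid S R)" "Y \<in> carrier (presented_monoid S R)"
    "Z \<in> carrier (presented_monoid S R)"
  then obtain u v w where uvw: "X = word_class u" "Y = word_class v" "Z = word_class w"
    "u \<in> lists S" "v \<in> lists S" "w \<in> lists S"
    unfolding carrier_presented by blast
  show "X = Y" if "Z \<otimes>\<^bsub>presented_monoid S R\<^esub> X = Z \<otimes>\<^bsub>presented_monoid S R\<^esub> Y"
  proof -
    have "w @ u \<approx> w @ v"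
      using that word_class_eq [of "w @ u" "w @ v"] uvw mult_presented by simp
    then show ?thesis using left_cancel word_class_cong uvw by blast
  qed
  show "X = Y" if "X \<otimes>\<^bsub>presented_monoid S R\<^esub> Z = Y \<otimes>\<^bsub>presented_monoid S R\<^esub> Z"
  proof -
    have "u @ w \<approx> v @ w"
      using that word_class_eq [of "u @ w" "v @ w"] uvw mult_presented by simp
    then show ?thesis using right_cancel word_class_cong uvw by blast
  qed
qed

lemma conical_presented: "conical (presented_monoid S R)"
  unfolding conical_def
proof (intro ballI impI)
  fix X Y
  assume XY: "X \<otimes>\<^bsub>presented_monoid S R\<^esub> Y = \<one>\<^bsub>presented_monoid S R\<^esub>"
    "X \<in> carrier (presented_monoid S R)" "Y \<in> carrier (presented_monoid S R)"
  then obtain u v where uv: "X = word_class u" "Y = word_class v" "u \<in> lists S" "v \<in> lists S"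
    unfolding carrier_presented by blast
  then have "u @ v \<approx> []"
    using XY word_class_eq [of "u @ v" "[]"] mult_presented one_presented by simp
  then show "X = \<one>\<^bsub>presented_monoid S R\<^esub> \<and> Y = \<one>\<^bsub>presented_monoid S R\<^esub>"
    using uv one_presented by simp
qed

lemma is_right_lcm_presented:
  assumes "right_lcm u v c"
  shows "is_right_lcm (presented_monoid S R) (word_class u) (word_class v) (word_class c)"
proof -
  have w: "u \<in> lists S" "v \<in> lists S" "c \<in> lists S"
    using assms left_dvd_words unfolding right_lcm_def by blast+
  then show ?thesis
    using assms unfolding is_right_lcm_def right_lcm_def
    by (auto simp: carrier_presented divides_presented)
qed

lemma is_left_lcm_presented:
  assumes "right_lcm (rev u) (rev v) (rev c)"
  shows "is_left_lcm (presented_monoid S R) (word_class u) (word_class v) (word_class c)"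
proof -
  have "rev u \<in> lists S" "rev v \<in> lists S" "rev c \<in> lists S"
    using assms left_dvd_words unfolding right_lcm_def by blast+
  then have w: "u \<in> lists S" "v \<in> lists S" "c \<in> lists S" by auto
  then show ?thesis
    using assms unfolding is_left_lcm_def right_lcm_def
    by (auto simp: carrier_presented right_divides_presented)
qed

text \<open>
  If \<open>z = u w\<close> is central, then \<open>u z = z u = u w u\<close>, and cancelling \<open>u\<close> gives \<open>z = w u\<close>: left and right
  divisors of a central element coincide.
\<close>

lemma left_dvd_central_iff_rev:
  assumes central: "\<And>a. a \<in> S \<Longrightarrow> a # z \<approx> z @ [a]" and z: "z \<in> lists S" and u: "u \<in> lists S"
  shows "u \<preceq> z \<longleftrightarrow> rev u \<preceq> rev z"
proof -
  have commute: "w @ z \<approx> z @ w" if "w \<in> lists S" for w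
    using equivalent_central_power [OF central z that, of 1] by simp
  show ?thesis
  proof
    assume "u \<preceq> z"
    then obtain w where w: "w \<in> lists S" "z \<approx> u @ w" by (rule left_dvdE)
    have "u @ z \<approx> (u @ w) @ u"
      using commute [OF u] equivalent_append_right [OF w(2) u] equivalent_trans by blast
    then have "z \<approx> w @ u" using left_cancel [of u] by simp
    then have "rev z \<approx> rev u @ rev w" using equivalent_rev_iff [of z "w @ u"] by simp
    then show "rev u \<preceq> rev z" unfolding left_dvd_def by blast
  next
    assume "rev u \<preceq> rev z"
    then obtain w where w: "w \<in> lists S" "rev z \<approx> rev u @ w" by (rule left_dvdE)
    then have w': "rev w \<in> lists S" "z \<approx> rev w @ u"
      using equivalent_rev_iff [of z "rev w @ u"] by auto
    \<comment> \<open>The mirror image: with \<open>v = rev w\<close>, \<open>u v u = u z = z u\<close>, and \<open>u\<close> is cancelled on the right.\<close>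
    have "u @ rev w @ u \<approx> z @ u"
      using commute [OF u] equivalent_append_left [OF equivalent_sym [OF w'(2)] u]
        equivalent_trans by blast
    then have "z \<approx> u @ rev w" using right_cancel [of "u @ rev w" u z] equivalent_sym by simp
    then show "u \<preceq> z" unfolding left_dvd_def by blast
  qed
qed

lemma finite_divisor_words:
  assumes "finite S" shows "finite {u. u \<preceq> z}"
proof (rule finite_subset)
  show "{u. u \<preceq> z} \<subseteq> {u. set u \<subseteq> S \<and> length u \<le> weight z}"
  proof clarify
    fix u assume "u \<preceq> z"
    then have "u \<in> lists S" "weight u \<le> weight z"
      using left_dvd_words left_dvd_weight by blast+
    then show "set u \<subseteq> S \<and> length u \<le> weight z"
      using length_le_weight [of u] by (auto simp: in_lists_conv_set)
  qed
  show "finite {u. set u \<subseteq> S \<and> length u \<le> weight z}"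
    using assms by (rule finite_lists_length_le)
qed

lemma garside_element_presented:
  assumes "finite S" and central: "\<And>a. a \<in> S \<Longrightarrow> a # z \<approx> z @ [a]"
    and letters: "\<And>a. a \<in> S \<Longrightarrow> [a] \<preceq> z" and z: "z \<in> lists S"
  shows "garside_element (presented_monoid S R) (word_class z)"
  unfolding garside_element_def
proof (intro conjI)
  let ?M = "presented_monoid S R"
  have left: "left_divisors ?M (word_class z) = word_class ` {u. u \<preceq> z}"
    unfolding left_divisors_def carrier_presented
    using z left_dvd_words by (auto simp: divides_presented)
  have "right_divisors ?M (word_class z) = word_class ` {u \<in> lists S. rev u \<preceq> rev z}"
    unfolding right_divisors_def carrier_presented
    using z by (auto simp: right_divides_presented)
  moreover have "{u. u \<preceq> z} = {u \<in> lists S. rev u \<preceq> rev z}"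
    using left_dvd_central_iff_rev [OF central z] left_dvd_words by blast
  ultimately show "left_divisors ?M (word_class z) = right_divisors ?M (word_class z)"
    using left by simp
  show "finite (left_divisors ?M (word_class z))"
    unfolding left using finite_divisor_words [OF assms(1)] by blast
  show "word_class z \<in> carrier ?M" using z carrier_presented by blast
  show "(\<lambda>H. submonoid H ?M) hull left_divisors ?M (word_class z) = carrier ?M"
  proof (rule hull_unique)
    show "left_divisors ?M (word_class z) \<subseteq> carrier ?M" unfolding left_divisors_def by blast
    show "submonoid (carrier ?M) ?M"
      using monoid_presented monoid.m_closed monoid.one_closed by (intro submonoid.intro) auto
    fix H assume H: "left_divisors ?M (word_class z) \<subseteq> H" "submonoid H ?M"
    have "word_class u \<in> H" if "u \<in> lists S" for u
      using that
    proof (induction u)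
      case Nil
      then show ?case using submonoid.one_closed [OF H(2)] one_presented by simp
    next
      case (Cons a u)
      then have "word_class [a] \<in> H" using H(1) letters unfolding left by blast
      then have "word_class [a] \<otimes>\<^bsub>?M\<^esub> word_class u \<in> H"
        using Cons submonoid.m_closed [OF H(2)] by blast
      then show ?case using Cons mult_presented [of "[a]" u] by auto
    qed
    then show "carrier ?M \<subseteq> H" unfolding carrier_presented by blast
  qed
qed

theorem garside_monoid_presented:
  assumes "finite S" "\<And>a. a \<in> S \<Longrightarrow> a # z \<approx> z @ [a]" "\<And>a. a \<in> S \<Longrightarrow> [a] \<preceq> z" "z \<in> lists S"
    and lcm: "\<And>u v. u \<in> lists S \<Longrightarrow> v \<in> lists S \<Longrightarrow> \<exists>c. right_lcm u v c"
  shows "garside_monoid (presented_monoid S R)"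
  unfolding garside_monoid_def
proof (intro conjI ballI monoid_cancel_presented conical_presented)
  show "\<exists>g. garside_element (presented_monoid S R) g"
    using garside_element_presented assms(1-4) by blast
  fix X Y assume "X \<in> carrier (presented_monoid S R)" "Y \<in> carrier (presented_monoid S R)"
  then obtain u v where uv: "X = word_class u" "Y = word_class v" "u \<in> lists S" "v \<in> lists S"
    unfolding carrier_presented by blast
  then obtain c d where "right_lcm u v c" "right_lcm (rev u) (rev v) d"
    using lcm by (metis rev_in_lists)
  then show "\<exists>c. is_right_lcm (presented_monoid S R) X Y c"
    "\<exists>c. is_left_lcm (presented_monoid S R) X Y c"
    using is_right_lcm_presented is_left_lcm_presented [of u v "rev d"] uv by auto
qed

end

section \<open>Tree presentations with positive exponents\<close>

text \<open>
  The tree is recorded only through a history of its growth, one leaf \<open>c\<close> at a vertex \<open>b\<close> at a time,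
  because each such step is one amalgamation.
\<close>

inductive tree_presentation :: "'a set \<Rightarrow> ('a list \<times> 'a list) set \<Rightarrow> bool" where
  single: "tree_presentation {a} {}"
| leaf: "tree_presentation S R \<Longrightarrow> b \<in> S \<Longrightarrow> c \<notin> S \<Longrightarrow> 0 < n \<Longrightarrow> 0 < m \<Longrightarrow>
    tree_presentation (insert c S) (insert (replicate n b, replicate m c) R)"

lemma replicate_in_lists: "a \<in> S \<Longrightarrow> replicate k a \<in> lists S"
  by (induction k) auto

lemma concat_replicate_replicate: "concat (replicate k (replicate n a)) = replicate (k * n) a"
  by (induction k) (auto simp: replicate_add)

lemma tree_presentation_finite: "tree_presentation S R \<Longrightarrow> finite S \<and> S \<noteq> {}"
  by (induction rule: tree_presentation.induct) auto

lemma tree_presentation_palindromes: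
  "tree_presentation S R \<Longrightarrow> (l, r) \<in> R \<Longrightarrow> rev l = l \<and> rev r = r"
  by (induction rule: tree_presentation.induct) auto

lemma tree_presentation_presentation: "tree_presentation S R \<Longrightarrow> presentation S R"
proof (induction rule: tree_presentation.induct)
  case (leaf S R b c n m)
  have "lists S \<subseteq> lists (insert c S)" by (intro lists_mono) auto
  then show ?case
    using leaf replicate_in_lists [of b "insert c S" n] replicate_in_lists [of c "insert c S" m]
    unfolding presentation_def by blast
qed (simp add: presentation_def)

lemma sum_list_map_cong: "w \<in> lists S \<Longrightarrow> (\<And>a. a \<in> S \<Longrightarrow> f a = g a) \<Longrightarrow> sum_list (map f w) = sum_list (map g w)"
  by (induction w) auto

text \<open>
  The relation \<open>b\<^sup>n = c\<^sup>m\<close> for a new leaf asks for weights \<open>g\<close> with \<open>n g b = m g c\<close>.  To solve this in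
  integers the old weights are multiplied by \<open>m\<close>.
\<close>

lemma tree_presentation_weight:
  "tree_presentation S R \<Longrightarrow> \<exists>f :: 'a \<Rightarrow> nat. (\<forall>a \<in> S. 0 < f a) \<and>
    (\<forall>(l, r) \<in> R. sum_list (map f l) = sum_list (map f r))"
proof (induction rule: tree_presentation.induct)
  case (single a)
  show ?case by (intro exI [of _ "\<lambda>_. 1"]) simp
next
  case (leaf S R b c n m)
  then obtain f :: "'a \<Rightarrow> nat" where f: "\<And>a. a \<in> S \<Longrightarrow> 0 < f a"
    "\<And>l r. (l, r) \<in> R \<Longrightarrow> sum_list (map f l) = sum_list (map f r)" by blast
  define g where "g a = (if a = c then n * f b else m * f a)" for a
  have g: "sum_list (map g w) = m * sum_list (map f w)" if "w \<in> lists S" for w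
  proof -
    have "sum_list (map g w) = sum_list (map (\<lambda>a. m * f a) w)"
      using that by (rule sum_list_map_cong) (use leaf(3) in \<open>auto simp: g_def\<close>)
    then show ?thesis by (simp add: sum_list_const_mult)
  qed
  have "sum_list (map g l) = sum_list (map g r)" if "(l, r) \<in> R" for l r
  proof -
    have "l \<in> lists S \<and> r \<in> lists S"
      using that tree_presentation_presentation [OF leaf(1)] unfolding presentation_def by blast
    then show ?thesis using g f(2) that by simp
  qed
  moreover have "sum_list (map g (replicate n b)) = sum_list (map g (replicate m c))"
    using leaf(2,3) by (auto simp: sum_list_replicate g_def)
  moreover have "0 < g a" if "a \<in> insert c S" for a
    using that f(1) leaf by (auto simp: g_def)
  ultimately show ?case by (intro exI [of _ g]) auto
qed

text \<open>
  If all letters have a common power, equal to \<open>b\<^sup>N\<close>, then its \<open>n\<close>-th power is \<open>(b\<^sup>n)\<^sup>N = (c\<^sup>m)\<^sup>N\<close>,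
  which is also a power of the new leaf.
\<close>

lemma tree_presentation_common_power:
  "tree_presentation S R \<Longrightarrow> \<exists>N. (\<forall>a \<in> S. 0 < N a) \<and>
    (\<forall>a \<in> S. \<forall>b \<in> S. (replicate (N a) a, replicate (N b) b) \<in> presentation_cong S R)"
proof (induction rule: tree_presentation.induct)
  case (single a)
  show ?case
    by (intro exI [of _ "\<lambda>_. 1"]) (auto intro!: presentation_cong.refl)
next
  case (leaf S R b c n m)
  then obtain N where N: "\<And>a. a \<in> S \<Longrightarrow> 0 < N a"
    "\<And>a b. a \<in> S \<Longrightarrow> b \<in> S \<Longrightarrow> (replicate (N a) a, replicate (N b) b) \<in> presentation_cong S R"
    by blast
  let ?R = "insert (replicate n b, replicate m c) R"
  interpret presentation "insert c S" ?R
    using leaf by (intro tree_presentation_presentation tree_presentation.leaf)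
  define N' where "N' a = (if a = c then N b * m else n * N a)" for a
  let ?E = "presentation_cong (insert c S) ?R"
  have key: "(replicate (N' a) a, replicate (n * N b) b) \<in> ?E" if "a \<in> insert c S" for a
  proof (cases "a = c")
    case True
    have "(replicate n b, replicate m c) \<in> ?E" by (rule equivalent_relation) simp
    then have "(replicate (N b * m) c, replicate (N b * n) b) \<in> ?E"
      using equivalent_power equivalent_sym concat_replicate_replicate by metis
    then show ?thesis using True by (simp add: N'_def mult.commute)
  next
    case False
    then have "(replicate (N a) a, replicate (N b) b) \<in> ?E"
      using that N(2) leaf(2) presentation_cong_mono [of _ _ S R "insert c S" ?R] by blast
    then have "(replicate (n * N a) a, replicate (n * N b) b) \<in> ?E"
      using equivalent_power concat_replicate_replicate by metis
    then show ?thesis using False by (simp add: N'_def)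
  qed
  have "0 < N' a" if "a \<in> insert c S" for a
    using that N(1) leaf by (auto simp: N'_def)
  moreover have "(replicate (N' a) a, replicate (N' a') a') \<in> ?E"
    if "a \<in> insert c S" "a' \<in> insert c S" for a a'
    using key that equivalent_sym equivalent_trans by blast
  ultimately show ?case by (intro exI [of _ N']) blast
qed

text \<open>
  A common power of all letters commutes with each of them.
\<close>

lemma tree_presentation_central:
  assumes "tree_presentation S R"
  obtains z where "z \<in> lists S" "\<And>a. a \<in> S \<Longrightarrow> presentation.left_dvd S R [a] z"
    "\<And>a. a \<in> S \<Longrightarrow> (a # z, z @ [a]) \<in> presentation_cong S R"
proof -
  interpret presentation S R using assms by (rule tree_presentation_presentation)
  obtain N where N: "\<And>a. a \<in> S \<Longrightarrow> 0 < N a"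
    "\<And>a b. a \<in> S \<Longrightarrow> b \<in> S \<Longrightarrow> replicate (N a) a \<approx> replicate (N b) b"
    using tree_presentation_common_power [OF assms] by blast
  obtain b where b: "b \<in> S" using tree_presentation_finite [OF assms] by blast
  show ?thesis
  proof
    show "replicate (N b) b \<in> lists S" using b by (rule replicate_in_lists)
    fix a assume a: "a \<in> S"
    then obtain k where "N a = Suc k" using N(1) not0_implies_Suc by blast
    then have "replicate (N b) b \<approx> [a] @ replicate k a" using N(2) [OF b a] by simp
    then show "[a] \<preceq> replicate (N b) b" unfolding left_dvd_def by blast
    have "a # replicate (N b) b \<approx> a # replicate (N a) a"
      using N(2) [OF b a] a by (rule equivalent_Cons)
    also have "a # replicate (N a) a = replicate (N a) a @ [a]"
      by (simp add: replicate_append_same)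
    also have "(replicate (N a) a @ [a], replicate (N b) b @ [a]) \<in> presentation_cong S R"
      using N(2) [OF a b] a by (intro equivalent_append_right) auto
    finally show "a # replicate (N b) b \<approx> replicate (N b) b @ [a]" .
  qed
qed

lemma (in left_cancellative_presentation) tree_presentation_right_lcm:
  assumes "tree_presentation S R"
    and "\<And>a b. a \<in> S \<Longrightarrow> b \<in> S \<Longrightarrow> \<exists>c. right_lcm [a] [b] c"
    and "u \<in> lists S" "v \<in> lists S"
  shows "\<exists>c. right_lcm u v c"
proof -
  obtain z where "z \<in> lists S" "\<And>a. a \<in> S \<Longrightarrow> [a] \<preceq> z" "\<And>a. a \<in> S \<Longrightarrow> a # z \<approx> z @ [a]"
    using assms(1) by (rule tree_presentation_central) blast
  then obtain w where "u \<preceq> w" "v \<preceq> w" using common_multiple_if_central assms(3,4) by blast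
  then show ?thesis using right_lcm_if_letters assms(2) by blast
qed

lemma tree_presentation_homogeneous: "tree_presentation S R \<Longrightarrow> homogeneous_presentation S R"
  by (intro homogeneous_presentation.intro homogeneous_presentation_axioms.intro
      tree_presentation_presentation tree_presentation_weight)

lemma single_left_cancellative: "left_cancellative_presentation {a} {}"
proof -
  interpret homogeneous_presentation "{a}" "{}"
    by (intro tree_presentation_homogeneous tree_presentation.single)
  have eq: "u = v" if "(u, v) \<in> presentation_cong {a} {}" for u v
    using that by (induction rule: presentation_cong.induct) auto
  show ?thesis
  proof
    fix b u v assume bu: "(b # u, b # v) \<in> presentation_cong {a} {}"
    then have "u \<in> lists {a}" "u = v" using eq [OF bu] equivalent_words [OF bu] by auto
    then show "(u, v) \<in> presentation_cong {a} {}" by simp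
  qed
qed

text \<open>
  Adding a leaf \<open>c\<close> is amalgamation with the free monoid on \<open>c\<close>, whose only letter divides the
  amalgamated element \<open>c\<^sup>m\<close>.
\<close>

lemma tree_presentation_left:
  "tree_presentation S R \<Longrightarrow> left_cancellative_presentation S R \<and>
    (\<forall>u \<in> lists S. \<forall>v \<in> lists S. \<exists>c. presentation.right_lcm S R u v c)"
proof (induction rule: tree_presentation.induct)
  case (single a)
  interpret left_cancellative_presentation "{a}" "{}" by (rule single_left_cancellative)
  have "right_lcm [a] [a] [a]" unfolding right_lcm_def by simp
  then show ?case
    using tree_presentation_right_lcm [OF tree_presentation.single]
      left_cancellative_presentation_axioms by blast
next
  case (leaf S R b c n m)
  interpret single: left_cancellative_presentation "{c}" "{}" by (rule single_left_cancellative)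
  have single_lcm: "\<exists>d. single.right_lcm u v d" if "u \<in> lists {c}" "v \<in> lists {c}" for u v
  proof (rule single.tree_presentation_right_lcm [OF tree_presentation.single _ that])
    have "single.right_lcm [c] [c] [c]" unfolding single.right_lcm_def by simp
    then show "\<And>a b. a \<in> {c} \<Longrightarrow> b \<in> {c} \<Longrightarrow> \<exists>d. single.right_lcm [a] [b] d" by blast
  qed
  let ?S = "\<lambda>i. if i then S else {c}" and ?R = "\<lambda>i. if i then R else {}"
    and ?x = "\<lambda>i. if i then replicate n b else replicate m c"
  interpret amalgam ?S ?R ?x
  proof (rule amalgam.intro)
    show "left_cancellative_presentation (?S i) (?R i)" for i
      using leaf single.left_cancellative_presentation_axioms by simp
    show "?x i \<in> lists (?S i)" for i using leaf by (simp add: replicate_in_lists)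
  qed (use leaf in auto)
  have letters: "all_letters = insert c S" unfolding all_letters_def by auto
  have relations: "all_relations = insert (replicate n b, replicate m c) R"
    unfolding all_relations_def by auto
  have tree: "tree_presentation all_letters all_relations"
    unfolding letters relations using leaf by (intro tree_presentation.leaf)
  interpret total: left_cancellative_presentation all_letters all_relations
    using tree_presentation_homogeneous [OF tree] left_cancel_amalgam
    unfolding left_cancellative_presentation_def left_cancellative_presentation_axioms_def by blast
  have "\<exists>d. amalgam.right_lcm [a] [a'] d" if "a \<in> all_letters" "a' \<in> all_letters" for a a'
  proof (rule right_lcm_letters)
    obtain k where "m = Suc k" using leaf not0_implies_Suc by blast
    then show "\<And>a. a \<in> ?S False \<Longrightarrow> factor.left_dvd False [a] (?x False)"
      using single.left_dvd_append [of "[c]" "replicate k c"] replicate_in_lists [of c "{c}" k] by simp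
    show "\<exists>d. factor.right_lcm i u v d" if "u \<in> lists (?S i)" "v \<in> lists (?S i)" for i u v
      using that leaf single_lcm by (cases i) auto
  qed (use that in auto)
  then have "\<exists>d. amalgam.right_lcm u v d" if "u \<in> lists all_letters" "v \<in> lists all_letters" for u v
    using total.tree_presentation_right_lcm tree that by blast
  then show ?case
    using total.left_cancellative_presentation_axioms unfolding letters relations by blast
qed

theorem tree_presentation_garside:
  assumes "tree_presentation S R" shows "garside_monoid (presented_monoid S R)"
proof -
  interpret left_cancellative_presentation S R using tree_presentation_left [OF assms] by blast
  interpret reversible_presentation S R
    by unfold_locales (use tree_presentation_palindromes [OF assms] in auto)
  obtain z where "z \<in> lists S" "\<And>a. a \<in> S \<Longrightarrow> [a] \<preceq> z" "\<And>a. a \<in> S \<Longrightarrow> a # z \<approx> z @ [a]"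
    using assms by (rule tree_presentation_central) blast
  then show ?thesis
    using tree_presentation_finite [OF assms] tree_presentation_left [OF assms]
    by (intro garside_monoid_presented [of z]) auto
qed

section \<open>Group presentations\<close>

definition invert :: "('a \<times> bool) list \<Rightarrow> ('a \<times> bool) list" where
  "invert w = rev (map (\<lambda>(a, e). (a, \<not> e)) w)"

lemma invert_invert [simp]: "invert (invert w) = w"
  unfolding invert_def by (induction w) auto

lemma invert_replicate [simp]: "invert (replicate k (a, e)) = replicate k (a, \<not> e)"
  unfolding invert_def by (simp add: rev_map)

lemma invert_words [simp]: "invert w \<in> lists (S \<times> UNIV) \<longleftrightarrow> w \<in> lists (S \<times> UNIV)"
  unfolding invert_def by (induction w) auto

locale group_presentation =
  fixes S :: "'a set" and R :: "(('a \<times> bool) list \<times> ('a \<times> bool) list) set"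
  assumes relators_words: "R \<subseteq> lists (S \<times> UNIV) \<times> lists (S \<times> UNIV)"
begin

definition "all_relators = R \<union> {([(a, e), (a, \<not> e)], []) | a e. a \<in> S}"

sublocale presentation "S \<times> UNIV" all_relators
  unfolding all_relators_def using relators_words by unfold_locales auto

lemma presented_group_eq: "presented_group S R = presented_monoid (S \<times> UNIV) all_relators"
  unfolding presented_group_def all_relators_def ..

lemma append_invert:
  "w \<in> lists (S \<times> UNIV) \<Longrightarrow> (w @ invert w, []) \<in> presentation_cong (S \<times> UNIV) all_relators"
proof (induction w)
  case Nil
  then show ?case by (simp add: invert_def)
next
  case (Cons x w)
  obtain a e where x: "x = (a, e)" by fastforce
  with Cons have ae: "a \<in> S" "w \<in> lists (S \<times> UNIV)" by auto
  have "([x] @ (w @ invert w) @ [(a, \<not> e)], [x] @ [] @ [(a, \<not> e)])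
      \<in> presentation_cong (S \<times> UNIV) all_relators"
    using Cons ae x by (intro equivalent_context) auto
  moreover have "([(a, e), (a, \<not> e)], []) \<in> presentation_cong (S \<times> UNIV) all_relators"
    using ae by (intro equivalent_relation) (auto simp: all_relators_def)
  ultimately show ?case using equivalent_trans x by (auto simp: invert_def)
qed

lemma invert_append:
  "w \<in> lists (S \<times> UNIV) \<Longrightarrow> (invert w @ w, []) \<in> presentation_cong (S \<times> UNIV) all_relators"
  using append_invert [of "invert w"] by simp

lemma equivalent_invert:
  assumes "(u, v) \<in> presentation_cong (S \<times> UNIV) all_relators"
  shows "(invert u, invert v) \<in> presentation_cong (S \<times> UNIV) all_relators"
proof -
  let ?E = "presentation_cong (S \<times> UNIV) all_relators"
  have uv: "u \<in> lists (S \<times> UNIV)" "v \<in> lists (S \<times> UNIV)"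
    using equivalent_words [OF assms] by auto
  have "(invert u, invert u @ v @ invert v) \<in> ?E"
    using equivalent_append_left [OF equivalent_sym [OF append_invert [OF uv(2)]]] uv by simp
  moreover have "(invert u @ v @ invert v, invert u @ u @ invert v) \<in> ?E"
    using assms uv equivalent_sym by (intro equivalent_context) auto
  moreover have "(invert u @ u @ invert v, invert v) \<in> ?E"
    using equivalent_append_right [OF invert_append [OF uv(1)], of "invert v"] uv by simp
  ultimately show ?thesis using equivalent_trans by blast
qed

lemma group_presented: "group (presented_group S R)"
  unfolding presented_group_eq
proof (rule monoid.group_l_invI [OF monoid_presented])
  fix X assume "X \<in> carrier (presented_monoid (S \<times> UNIV) all_relators)"
  then obtain u where u: "X = word_class u" "u \<in> lists (S \<times> UNIV)"
    unfolding carrier_presented by blast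
  then have "word_class (invert u) \<otimes>\<^bsub>presented_monoid (S \<times> UNIV) all_relators\<^esub> X = word_class []"
    using mult_presented [of "invert u" u] word_class_cong [OF invert_append] by simp
  moreover have "word_class (invert u) \<in> carrier (presented_monoid (S \<times> UNIV) all_relators)"
    unfolding carrier_presented using u by simp
  ultimately show "\<exists>Y \<in> carrier (presented_monoid (S \<times> UNIV) all_relators).
      Y \<otimes>\<^bsub>presented_monoid (S \<times> UNIV) all_relators\<^esub> X = \<one>\<^bsub>presented_monoid (S \<times> UNIV) all_relators\<^esub>"
    unfolding one_presented by blast
qed

end

text \<open>
  Checking the relations on generators is enough to map one presented monoid to another.
\<close>

lemma presentation_cong_map:
  assumes "(u, v) \<in> presentation_cong S R" "h ` S \<subseteq> S'"
    and "\<And>l r. (l, r) \<in> R \<Longrightarrow> (map h l, map h r) \<in> presentation_cong S' R'"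
    and "presentation S' R'"
  shows "(map h u, map h v) \<in> presentation_cong S' R'"
proof -
  interpret presentation S' R' by fact
  have words: "map h w \<in> lists S'" if "w \<in> lists S" for w
    using that assms(2) by (induction w) auto
  show ?thesis
    using assms(1)
  proof (induction rule: presentation_cong.induct)
    case (refl w)
    then show ?case using words equivalent_refl by blast
  next
    case (sym u v)
    then show ?case using equivalent_sym by blast
  next
    case (trans u v w)
    then show ?case using equivalent_trans by blast
  next
    case (rel l r u v)
    then show ?case using words assms(3) equivalent_context by simp
  qed
qed

lemma presented_monoid_iso:
  assumes "presentation S R" "presentation S' R'" "bij_betw h S S'"
    and forward: "\<And>l r. (l, r) \<in> R \<Longrightarrow> (map h l, map h r) \<in> presentation_cong S' R'"
    and backward: "\<And>l r. (l, r) \<in> R' \<Longrightarrow>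
      (map (inv_into S h) l, map (inv_into S h) r) \<in> presentation_cong S R"
  shows "presented_monoid S R \<cong> presented_monoid S' R'"
proof -
  interpret A: presentation S R by fact
  interpret B: presentation S' R' by fact
  let ?g = "inv_into S h"
  have hg: "map h (map ?g w) = w" "map ?g w \<in> lists S" if "w \<in> lists S'" for w
    using that assms(3)
    by (induction w) (auto simp: bij_betw_def f_inv_into_f intro: inv_into_into)
  have gh: "map ?g (map h w) = w" "map h w \<in> lists S'" if "w \<in> lists S" for w
    using that assms(3) by (induction w) (auto simp: bij_betw_def)
  have iff: "A.equivalent u v \<longleftrightarrow> B.equivalent (map h u) (map h v)"
    if "u \<in> lists S" "v \<in> lists S" for u v
  proof
    assume "A.equivalent u v"
    then show "B.equivalent (map h u) (map h v)"
      using presentation_cong_map [of u v S R h S' R'] assms unfolding bij_betw_def by blast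
  next
    assume "B.equivalent (map h u) (map h v)"
    moreover have "?g ` S' \<subseteq> S"
      using bij_betw_inv_into [OF assms(3)] unfolding bij_betw_def by blast
    ultimately have "A.equivalent (map ?g (map h u)) (map ?g (map h v))"
      using presentation_cong_map [of "map h u" "map h v" S' R' ?g S R] backward assms(1) by blast
    then show "A.equivalent u v" using gh that by simp
  qed
  define \<phi> where "\<phi> X = B.word_class (map h (SOME u. u \<in> lists S \<and> X = A.word_class u))" for X
  have \<phi>: "\<phi> (A.word_class u) = B.word_class (map h u)" if "u \<in> lists S" for u
  proof -
    let ?v = "SOME v. v \<in> lists S \<and> A.word_class u = A.word_class v"
    have v: "?v \<in> lists S \<and> A.word_class u = A.word_class ?v"
      using someI [of "\<lambda>v. v \<in> lists S \<and> A.word_class u = A.word_class v" u] that by simp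
    then have "A.equivalent u ?v" using A.word_class_eq that by blast
    then have "B.equivalent (map h u) (map h ?v)" using iff that v by blast
    then show ?thesis unfolding \<phi>_def by (simp add: B.word_class_cong)
  qed
  have "\<phi> \<in> iso (presented_monoid S R) (presented_monoid S' R')"
  proof (rule isoI)
    show "\<phi> \<in> hom (presented_monoid S R) (presented_monoid S' R')"
    proof (rule homI)
      fix X assume "X \<in> carrier (presented_monoid S R)"
      then obtain u where "X = A.word_class u" "u \<in> lists S"
        unfolding A.carrier_presented by blast
      then show "\<phi> X \<in> carrier (presented_monoid S' R')"
        using \<phi> gh(2) unfolding B.carrier_presented by simp
      fix Y assume "Y \<in> carrier (presented_monoid S R)"
      then obtain v where "Y = A.word_class v" "v \<in> lists S"
        unfolding A.carrier_presented by blast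
      with \<open>X = A.word_class u\<close> \<open>u \<in> lists S\<close>
      show "\<phi> (X \<otimes>\<^bsub>presented_monoid S R\<^esub> Y) = \<phi> X \<otimes>\<^bsub>presented_monoid S' R'\<^esub> \<phi> Y"
        using \<phi> gh(2) A.mult_presented B.mult_presented by simp
    qed
    have "inj_on \<phi> (A.word_class ` lists S)"
    proof (rule inj_onI)
      fix X Y
      assume XY: "X \<in> A.word_class ` lists S" "Y \<in> A.word_class ` lists S" "\<phi> X = \<phi> Y"
      then obtain u v where uv: "X = A.word_class u" "Y = A.word_class v" "u \<in> lists S" "v \<in> lists S"
        by blast
      then have "B.word_class (map h u) = B.word_class (map h v)" using XY(3) \<phi> by simp
      then have "A.equivalent u v" using iff [OF uv(3,4)] B.word_class_eq gh(2) uv by simp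
      then show "X = Y" using uv A.word_class_cong by simp
    qed
    moreover have "\<phi> ` A.word_class ` lists S = B.word_class ` lists S'"
    proof
      show "\<phi> ` A.word_class ` lists S \<subseteq> B.word_class ` lists S'" using gh \<phi> by auto
      show "B.word_class ` lists S' \<subseteq> \<phi> ` A.word_class ` lists S"
      proof clarify
        fix w assume "w \<in> lists S'"
        then have "B.word_class w = \<phi> (A.word_class (map ?g w))" "map ?g w \<in> lists S"
          using hg \<phi> by metis+
        then show "B.word_class w \<in> \<phi> ` A.word_class ` lists S" by blast
      qed
    qed
    ultimately show "bij_betw \<phi> (carrier (presented_monoid S R)) (carrier (presented_monoid S' R'))"
      unfolding A.carrier_presented B.carrier_presented bij_betw_def by blast
  qed
  then show ?thesis unfolding is_iso_def by blast
qed

text \<open>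
  Exchanging some of the generators for their inverses does not change the group.  The relations only
  have to match up to consequences, because an edge on which both exponents become negative yields the
  inverse of the desired relation.
\<close>

lemma presented_group_sign_change:
  assumes inj: "inj_on f V" and "group_presentation V R" "group_presentation (f ` V) R'"
    and h: "h = (\<lambda>(a, e). (f a, e = \<epsilon> a))"
    and forward: "\<And>l r. (l, r) \<in> R \<Longrightarrow> (map h l, map h r)
      \<in> presentation_cong (f ` V \<times> UNIV) (group_presentation.all_relators (f ` V) R')"
    and backward: "\<And>l r. (l, r) \<in> R' \<Longrightarrow> \<exists>l' r'. l = map h l' \<and> r = map h r' \<and>
      (l', r') \<in> presentation_cong (V \<times> UNIV) (group_presentation.all_relators V R)"
  shows "presented_group V R \<cong> presented_group (f ` V) R'"
proof -
  interpret A: group_presentation V R by fact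
  interpret B: group_presentation "f ` V" R' by fact
  have inj_h: "inj_on h (V \<times> UNIV)"
    unfolding h using inj by (auto simp: inj_on_def)
  have "h ` (V \<times> UNIV) = f ` V \<times> UNIV"
  proof
    show "h ` (V \<times> UNIV) \<subseteq> f ` V \<times> UNIV" unfolding h by auto
    show "f ` V \<times> UNIV \<subseteq> h ` (V \<times> UNIV)"
    proof clarify
      fix a e assume "a \<in> V"
      moreover have "h (a, e = \<epsilon> a) = (f a, e)" unfolding h by auto
      ultimately show "(f a, e) \<in> h ` (V \<times> UNIV)" by (metis UNIV_I SigmaI imageI)
    qed
  qed
  with inj_h have bij: "bij_betw h (V \<times> UNIV) (f ` V \<times> UNIV)" by (simp add: bij_betw_def)
  have inv: "map (inv_into (V \<times> UNIV) h) (map h w) = w" if "w \<in> lists (V \<times> UNIV)" for w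
    using that inj_h by (induction w) auto
  show ?thesis
    unfolding A.presented_group_eq B.presented_group_eq
  proof (rule presented_monoid_iso [OF A.presentation_axioms B.presentation_axioms bij])
    fix l r assume lr: "(l, r) \<in> A.all_relators"
    show "(map h l, map h r) \<in> presentation_cong (f ` V \<times> UNIV) B.all_relators"
    proof (cases "(l, r) \<in> R")
      case False
      then obtain a e where a: "a \<in> V" "l = [(a, e), (a, \<not> e)]" "r = []"
        using lr unfolding A.all_relators_def by blast
      then have "map h l = [(f a, e = \<epsilon> a), (f a, \<not> (e = \<epsilon> a))]" "map h r = []"
        unfolding h by auto
      moreover have "([(f a, e = \<epsilon> a), (f a, \<not> (e = \<epsilon> a))], []) \<in> B.all_relators"
        using a(1) unfolding B.all_relators_def by blast
      ultimately have "(map h l, map h r) \<in> B.all_relators" by (simp only:)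
      then show ?thesis by (rule B.equivalent_relation)
    qed (rule forward)
  next
    fix l r assume lr: "(l, r) \<in> B.all_relators"
    let ?E = "presentation_cong (V \<times> UNIV) A.all_relators"
    have "\<exists>l' r'. l = map h l' \<and> r = map h r' \<and> (l', r') \<in> ?E"
    proof (cases "(l, r) \<in> R'")
      case False
      then obtain a e where a: "a \<in> V" "l = [(f a, e), (f a, \<not> e)]" "r = []"
        using lr unfolding B.all_relators_def by blast
      let ?l = "[(a, e = \<epsilon> a), (a, \<not> (e = \<epsilon> a))]"
      have "(?l, []) \<in> A.all_relators"
        using a(1) unfolding A.all_relators_def by blast
      then have "(?l, []) \<in> ?E" by (rule A.equivalent_relation)
      moreover have "l = map h ?l" "r = map h []" unfolding h a by auto
      ultimately show ?thesis by blast
    qed (rule backward)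
    then obtain l' r' where w: "l = map h l'" "r = map h r'" "(l', r') \<in> ?E" by blast
    then show "(map (inv_into (V \<times> UNIV) h) l, map (inv_into (V \<times> UNIV) h) r) \<in> ?E"
      using inv A.equivalent_words [OF w(3)] by simp
  qed
qed

section \<open>Finite trees\<close>

inductive subtree :: "'v pair_pre_digraph \<Rightarrow> 'v set \<Rightarrow> bool" for T where
  single: "v \<in> pverts T \<Longrightarrow> subtree T {v}"
| attach: "subtree T W \<Longrightarrow> b \<in> W \<Longrightarrow> c \<notin> W \<Longrightarrow> (b, c) \<in> parcs T \<Longrightarrow> subtree T (insert c W)"

context pair_graph
begin

lemma arc_sym: "(a, b) \<in> parcs G \<Longrightarrow> (b, a) \<in> parcs G"
  using pair_sym_arcs arcs_ends_symmetric [of "with_proj G"] by simp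

lemma subtree_subset: "subtree G W \<Longrightarrow> W \<subseteq> pverts G"
  by (induction rule: subtree.induct) (auto dest: in_arcsD2)

lemma pawalk_verts_snoc: "awalk a p b \<Longrightarrow> pawalk_verts a (p @ [(b, c)]) = pawalk_verts a p @ [c]"
  by (induction p arbitrary: a) (auto simp: awalk_def)

lemma subtree_apath:
  "subtree G W \<Longrightarrow> a \<in> W \<Longrightarrow> b \<in> W \<Longrightarrow> \<exists>p. apath a p b \<and> set (pawalk_verts a p) \<subseteq> W"
proof (induction arbitrary: a b rule: subtree.induct)
  case (single v)
  then show ?case by (intro exI [of _ "[]"]) (auto simp: apath_def awalk_def)
next
  case (attach W d c)
  have c: "c \<in> pverts G" using attach in_arcsD2 by blast
  consider "a \<in> W" "b \<in> W" | "a = c" "b = c" | "a = c" "b \<in> W" | "a \<in> W" "b = c"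
    using attach by blast
  then show ?case
  proof cases
    case 1
    then show ?thesis using attach.IH by blast
  next
    case 2
    then show ?thesis using c by (intro exI [of _ "[]"]) (auto simp: apath_def awalk_def)
  next
    case 3
    then obtain p where "apath d p b" "set (pawalk_verts d p) \<subseteq> W" using attach by blast
    then show ?thesis
      using 3 attach arc_sym
      by (intro exI [of _ "(c, d) # p"]) (auto simp: apath_def awalk_Cons_iff)
  next
    case 4
    then obtain p where p: "apath a p d" "set (pawalk_verts a p) \<subseteq> W" using attach by blast
    then have "awalk a (p @ [(d, c)]) c"
      using attach c in_arcsD1 by (auto simp: apath_def awalk_Cons_iff awalk_def)
    moreover have "pawalk_verts a (p @ [(d, c)]) = pawalk_verts a p @ [c]"
      using p pawalk_verts_snoc by (simp add: apath_def)
    ultimately show ?thesis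
      using p 4 attach by (intro exI [of _ "p @ [(d, c)]"]) (auto simp: apath_def)
  qed
qed

text \<open>
  Two neighbours of \<open>c\<close> in the subtree, a path between them inside the subtree and the two arcs to \<open>c\<close>
  form a cycle of length at least 3.
\<close>

lemma subtree_unique_neighbour:
  assumes acyclic: "\<not> (\<exists>p. cycle p \<and> 3 \<le> length p)"
    and W: "subtree G W" "c \<notin> W" "a \<in> W" "b \<in> W" and arcs: "(a, c) \<in> parcs G" "(b, c) \<in> parcs G"
  shows "a = b"
proof (rule ccontr)
  assume "a \<noteq> b"
  obtain p where p: "apath a p b" "set (pawalk_verts a p) \<subseteq> W"
    using subtree_apath W by blast
  with \<open>a \<noteq> b\<close> have "p \<noteq> []" by (auto simp: apath_def awalk_def)
  let ?q = "(c, a) # p @ [(b, c)]"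
  have tail: "awalk a (p @ [(b, c)]) c"
    using p arcs in_arcsD1 in_arcsD2 by (auto simp: apath_def awalk_Cons_iff awalk_def)
  have "pawalk_verts a (p @ [(b, c)]) = pawalk_verts a p @ [c]"
    using p pawalk_verts_snoc by (simp add: apath_def)
  then have "distinct (tl (pawalk_verts c ?q))"
    using p W by (auto simp: apath_def)
  moreover have "awalk c ?q c" using tail arc_sym [OF arcs(1)] unfolding awalk_Cons_iff by simp
  ultimately have "cycle ?q" unfolding cycle_def by blast
  moreover have "3 \<le> length ?q" using \<open>p \<noteq> []\<close> by (cases p) auto
  ultimately show False using acyclic by blast
qed

lemma subtree_all:
  assumes "connected (with_proj G)" shows "subtree G (pverts G)"
proof -
  have conn: "strongly_connected (with_proj G)"
    using symmetric_connected_imp_strongly_connected [OF pair_sym_arcs assms] .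
  then obtain v where v: "v \<in> pverts G" by (auto simp: strongly_connected_def)
  have ne: "{W. subtree G W} \<noteq> {}" using subtree.single [of v G, OF v] by blast
  have "finite {W. subtree G W}"
    by (rule finite_subset [of _ "Pow (pverts G)"]) (use subtree_subset pair_finite_verts in auto)
  \<comment> \<open>A maximal subtree has no arc leaving it, so by connectedness it contains every vertex.\<close>
  from finite_has_maximal [OF this ne] obtain W where W: "subtree G W"
    "\<And>W'. subtree G W' \<Longrightarrow> W \<subseteq> W' \<Longrightarrow> W = W'" by blast
  have closed: "c \<in> W" if "b \<in> W" "(b, c) \<in> parcs G" for b c
    using subtree.attach [OF W(1) that(1) _ that(2)] W(2) by blast
  obtain u where u: "u \<in> W" using W(1) by (cases rule: subtree.cases) auto
  have "x \<in> W" if "x \<in> pverts G" for x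
  proof -
    have "reachable (with_proj G) u x"
      using conn that u subtree_subset [OF W(1)] by (auto simp: strongly_connected_def)
    then show ?thesis
      by (induction rule: reachable_induct) (use u closed in auto)
  qed
  then have "W = pverts G" using subtree_subset [OF W(1)] by blast
  then show ?thesis using W(1) by simp
qed

text \<open>
  The flag \<open>\<epsilon> a\<close> tells whether the vertex \<open>a\<close> keeps its orientation; on each edge the two reoriented
  exponents are to have the same sign.  Since a new vertex has a single neighbour in the subtree, its
  flag is determined by that neighbour, without conflicting conditions.
\<close>

lemma subtree_presentation:
  fixes \<omega> :: "'a \<Rightarrow> 'a \<Rightarrow> int" and f :: "'a \<Rightarrow> 'b"
  defines "e \<equiv> (\<lambda>a b. replicate (nat \<bar>\<omega> a b\<bar>) (f a))"
  assumes acyclic: "\<not> (\<exists>p. cycle p \<and> 3 \<le> length p)"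
    and nonzero: "\<forall>(a, b) \<in> parcs G. \<omega> a b \<noteq> 0" and inj: "inj_on f (pverts G)"
  shows "subtree G W \<Longrightarrow> \<exists>\<epsilon> R. tree_presentation (f ` W) R \<and>
    (\<forall>a b. (a, b) \<in> parcs G \<and> a \<in> W \<and> b \<in> W \<longrightarrow>
       ((0 \<le> \<omega> a b) = \<epsilon> a) = ((0 \<le> \<omega> b a) = \<epsilon> b) \<and> ((e a b, e b a) \<in> R \<or> (e b a, e a b) \<in> R)) \<and>
    (\<forall>(l, r) \<in> R. \<exists>a b. (a, b) \<in> parcs G \<and> l = e a b \<and> r = e b a)"
proof (induction rule: subtree.induct)
  case (single v)
  then show ?case
    using tree_presentation.single pair_no_loops by (intro exI [of _ "\<lambda>_. True"] exI [of _ "{}"]) force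
next
  case (attach W b c)
  then obtain \<epsilon> R where tree: "tree_presentation (f ` W) R"
    and old: "\<And>a a'. (a, a') \<in> parcs G \<Longrightarrow> a \<in> W \<Longrightarrow> a' \<in> W \<Longrightarrow>
       ((0 \<le> \<omega> a a') = \<epsilon> a) = ((0 \<le> \<omega> a' a) = \<epsilon> a') \<and>
       ((e a a', e a' a) \<in> R \<or> (e a' a, e a a') \<in> R)"
    and R: "\<forall>(l, r) \<in> R. \<exists>a b. (a, b) \<in> parcs G \<and> l = e a b \<and> r = e b a"
    by blast
  have cb: "(c, b) \<in> parcs G" using attach arc_sym by blast
  have "f c \<notin> f ` W"
    using inj subtree_subset [OF attach(1)] in_arcsD2 [OF attach(4)] attach(3)
    by (simp add: inj_on_image_mem_iff)
  then have tree': "tree_presentation (insert (f c) (f ` W)) (insert (e b c, e c b) R)"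
    unfolding e_def using attach(2,4) cb tree nonzero by (intro tree_presentation.leaf) auto
  \<comment> \<open>The flag of \<open>c\<close> is the one that makes the sign condition hold on the edge to \<open>b\<close>.\<close>
  let ?\<epsilon> = "\<epsilon>(c := ((0 \<le> \<omega> c b) = ((0 \<le> \<omega> b c) = \<epsilon> b)))"
  have new: "((0 \<le> \<omega> a a') = ?\<epsilon> a) = ((0 \<le> \<omega> a' a) = ?\<epsilon> a') \<and>
      ((e a a', e a' a) \<in> insert (e b c, e c b) R \<or> (e a' a, e a a') \<in> insert (e b c, e c b) R)"
    if arc: "(a, a') \<in> parcs G" and mem: "a \<in> insert c W" "a' \<in> insert c W" for a a'
  proof -
    have "a \<noteq> a'" using pair_no_loops [OF arc] by simp
    then consider "a \<in> W" "a' \<in> W" | "a = c" "a' \<in> W" | "a \<in> W" "a' = c"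
      using mem by blast
    then show ?thesis
    proof cases
      case 1
      then have "a \<noteq> c" "a' \<noteq> c" using attach by auto
      then show ?thesis using old [OF arc] 1 by auto
    next
      case 2
      then have "a' = b"
        using subtree_unique_neighbour [OF acyclic] attach arc arc_sym by blast
      then show ?thesis using 2 attach by auto
    next
      case 3
      then have "a = b"
        using subtree_unique_neighbour [OF acyclic] attach arc by blast
      then show ?thesis using 3 attach by auto
    qed
  qed
  have "\<forall>(l, r) \<in> insert (e b c, e c b) R. \<exists>a b. (a, b) \<in> parcs G \<and> l = e a b \<and> r = e b a"
    using R attach(4) by auto
  then show ?case
    using tree' new by (intro exI [of _ ?\<epsilon>] exI [of _ "insert (e b c, e c b) R"]) (simp only: image_insert, blast)
qed

end

lemma positive_word_replicate [simp]: "positive_word (replicate k a) = replicate k (a, True)"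
  unfolding positive_word_def by simp

theorem corollary3p10:
  fixes T :: "'v pair_pre_digraph" and \<omega> :: "'v \<Rightarrow> 'v \<Rightarrow> int"
  assumes "finite_weighted_tree T \<omega>"
  shows "garside_group (tree_product T \<omega>)"
proof -
  interpret pair_graph T
    using assms unfolding finite_weighted_tree_def finite_tree_def by blast
  have nonzero: "\<forall>(a, b) \<in> parcs T. \<omega> a b \<noteq> 0"
    using assms unfolding finite_weighted_tree_def by blast
  have acyclic: "\<not> (\<exists>p. cycle p \<and> 3 \<le> length p)" and conn: "connected (with_proj T)"
    using assms unfolding finite_weighted_tree_def finite_tree_def by blast+
  let ?V = "pverts T"
  obtain f :: "'v \<Rightarrow> nat" where f: "inj_on f ?V"
    using finite_imp_inj_to_nat_seg [OF pair_finite_verts] by blast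
  let ?p = "\<lambda>a b. nat \<bar>\<omega> a b\<bar>"
  from subtree_presentation [where \<omega> = \<omega>, OF acyclic nonzero f subtree_all [OF conn]]
  obtain \<epsilon> R where tree: "tree_presentation (f ` ?V) R"
    and all_arcs: "\<forall>a b. (a, b) \<in> parcs T \<and> a \<in> ?V \<and> b \<in> ?V \<longrightarrow>
      ((0 \<le> \<omega> a b) = \<epsilon> a) = ((0 \<le> \<omega> b a) = \<epsilon> b) \<and>
      ((replicate (?p a b) (f a), replicate (?p b a) (f b)) \<in> R \<or>
       (replicate (?p b a) (f b), replicate (?p a b) (f a)) \<in> R)"
    and R: "\<forall>(l, r) \<in> R. \<exists>a b. (a, b) \<in> parcs T \<and>
      l = replicate (?p a b) (f a) \<and> r = replicate (?p b a) (f b)"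
    by (elim exE conjE)
  have signs: "((0 \<le> \<omega> a b) = \<epsilon> a) = ((0 \<le> \<omega> b a) = \<epsilon> b)"
    and arcs: "(replicate (?p a b) (f a), replicate (?p b a) (f b)) \<in> R \<or>
       (replicate (?p b a) (f b), replicate (?p a b) (f a)) \<in> R"
    if "(a, b) \<in> parcs T" for a b
    using all_arcs [THEN spec, THEN spec, THEN mp,
      OF conjI [OF that conjI [OF in_arcsD1 [OF that] in_arcsD2 [OF that]]]]
    by (rule conjunct1, rule conjunct2)
  let ?RT = "{(power_word a (\<omega> a b), power_word b (\<omega> b a)) | a b. (a, b) \<in> parcs T}"
  let ?RP = "(\<lambda>(l, r). (positive_word l, positive_word r)) ` R"
  have R_words: "R \<subseteq> lists (f ` ?V) \<times> lists (f ` ?V)"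
    using tree_presentation_presentation [OF tree] unfolding presentation_def .
  have words: "power_word a k \<in> lists (?V \<times> UNIV)" if "a \<in> ?V" for a k
    using that unfolding power_word_def by (intro replicate_in_lists) simp
  have "?RT \<subseteq> lists (?V \<times> UNIV) \<times> lists (?V \<times> UNIV)"
  proof (rule subsetI)
    fix z assume "z \<in> ?RT"
    then obtain a b where z: "z = (power_word a (\<omega> a b), power_word b (\<omega> b a))"
      and ab: "(a, b) \<in> parcs T"
      by blast
    show "z \<in> lists (?V \<times> UNIV) \<times> lists (?V \<times> UNIV)"
      unfolding z using words [OF in_arcsD1 [OF ab]] words [OF in_arcsD2 [OF ab]] by (rule SigmaI)
  qed
  then interpret A: group_presentation ?V ?RT by unfold_locales
  have positive: "positive_word w \<in> lists (S \<times> UNIV)" if "w \<in> lists S" for w and S :: "nat set"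
    using that unfolding positive_word_def by (induction w) auto
  interpret B: group_presentation "f ` ?V" ?RP
  proof (unfold_locales, rule subsetI)
    fix z assume "z \<in> ?RP"
    then obtain l r where "z = (positive_word l, positive_word r)" "(l, r) \<in> R" by auto
    then show "z \<in> lists (f ` ?V \<times> UNIV) \<times> lists (f ` ?V \<times> UNIV)"
      using positive subsetD [OF R_words] by blast
  qed
  define h where "h = (\<lambda>(a, e). (f a, e = \<epsilon> a))"
  have "presented_group ?V ?RT \<cong> presented_group (f ` ?V) ?RP"
  proof (rule presented_group_sign_change [OF f A.group_presentation_axioms B.group_presentation_axioms h_def])
    let ?E = "presentation_cong (f ` ?V \<times> UNIV) B.all_relators"
    fix l r assume "(l, r) \<in> ?RT"
    then obtain a b where ab: "(a, b) \<in> parcs T"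
      and l: "l = power_word a (\<omega> a b)" and r: "r = power_word b (\<omega> b a)" by blast
    have relator: "(positive_word v, positive_word w) \<in> ?E" if "(v, w) \<in> R" for v w
      using that by (intro B.equivalent_relation) (force simp: B.all_relators_def)
    \<comment> \<open>Both orientations of an edge are arcs, but only one of the two relations is sure to belong to \<open>R\<close>.\<close>
    have pos: "(replicate (?p a b) (f a, True), replicate (?p b a) (f b, True)) \<in> ?E"
      using arcs [OF ab] relator [of "replicate (?p a b) (f a)" "replicate (?p b a) (f b)"]
        relator [of "replicate (?p b a) (f b)" "replicate (?p a b) (f a)"]
        B.equivalent_sym by auto
    have "map h l = replicate (?p a b) (f a, (0 \<le> \<omega> a b) = \<epsilon> a)"
      "map h r = replicate (?p b a) (f b, (0 \<le> \<omega> a b) = \<epsilon> a)"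
      using signs [OF ab] unfolding l r h_def power_word_def by auto
    then show "(map h l, map h r) \<in> ?E"
      using pos B.equivalent_invert [OF pos] by (cases "(0 \<le> \<omega> a b) = \<epsilon> a") auto
  next
    let ?E = "presentation_cong (?V \<times> UNIV) A.all_relators"
    fix l r assume "(l, r) \<in> ?RP"
    then obtain v w where vw: "(v, w) \<in> R" "l = positive_word v" "r = positive_word w" by auto
    then obtain a b where ab: "(a, b) \<in> parcs T"
      and lr: "l = replicate (?p a b) (f a, True)" "r = replicate (?p b a) (f b, True)"
      using bspec [OF R vw(1)] by auto
    have "(power_word a (\<omega> a b), power_word b (\<omega> b a)) \<in> ?E"
      using ab by (intro A.equivalent_relation) (auto simp: A.all_relators_def)
    then have rel: "(replicate (?p a b) (a, 0 \<le> \<omega> a b), replicate (?p b a) (b, 0 \<le> \<omega> b a)) \<in> ?E"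
      unfolding power_word_def .
    have "(replicate (?p a b) (a, \<epsilon> a), replicate (?p b a) (b, \<epsilon> b)) \<in> ?E"
      using rel A.equivalent_invert [OF rel] signs [OF ab]
      by (cases "\<epsilon> a"; cases "\<epsilon> b"; cases "0 \<le> \<omega> a b"; cases "0 \<le> \<omega> b a") auto
    moreover have "l = map h (replicate (?p a b) (a, \<epsilon> a))" "r = map h (replicate (?p b a) (b, \<epsilon> b))"
      unfolding lr h_def by auto
    ultimately show "\<exists>l' r'. l = map h l' \<and> r = map h r' \<and> (l', r') \<in> ?E" by blast
  qed
  then have "tree_product T \<omega> \<cong> enveloping_group (f ` ?V) R"
    unfolding tree_product_def enveloping_group_def .
  moreover have "group (tree_product T \<omega>)"
    using A.group_presented unfolding tree_product_def .
  ultimately show ?thesis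
    using R_words tree_presentation_garside [OF tree] unfolding garside_group_def by blast
qed

end
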